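(* Let $(e^{tA})_{t\ge 0}$ be a real $C_0$-semigroup with generator $A$ on a complex Banach lattice $E$ with positive cone $E_+$. Assume that $s(A)>-\infty$. (i) Suppose that there is an increasing sequence $(P_n)_{n\in\mathbb{N}}$ of positive operators on $E$ converging strongly to the identity such that $(e^{tA})_{t\ge 0}$ has the LEP property with respect to $(P_n)_{n\in\mathbb{N}}$, and suppose that for every $f\in E$ the orbit $\{e^{tA}f : t\ge 0\}$ is relatively compact in $E$. Then for each $f\in E_+$ it holds that $\operatorname{dist}(e^{tA}f,E_+)\to 0$ as $t\to\infty$. (ii) Suppose that there is an increasing sequence $(Q_n)_{n\in\mathbb{N}}$ of lattice homomorphisms on $E$ converging strongly to the identity such that $(e^{tA})_{t\ge 0}$ has the strong LEP property with respect to $(Q_n)_{n\in\mathbb{N}}$, and suppose that for every $f\in E$ the orbit $\{e^{t(A-s(A))}f : t\ge 0\}$ of the rescaled semigroup is relatively weakly compact in $E$. Then $\sigma_p(A)\cap(s(A)+i\mathbb{R})\subseteq\{s(A)\}$, where $\sigma_p(A)$ denotes the point spectrum of $A$.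
   Context: A complex Banach lattice $E$ is the complexification of a real Banach lattice $E_{\mathbb{R}}$ (its real part); $E_+$ denotes the positive cone of $E_{\mathbb{R}}$. A linear operator $T$ on $E$ is positive if $T(E_+)\subseteq E_+$ and real if $T(E_{\mathbb{R}})\subseteq E_{\mathbb{R}}$; positive operators are real. A semigroup is real if each of its operators is real. A lattice homomorphism is a linear operator that (on real parts) preserves the lattice operations $\vee,\wedge$. A sequence $(P_n)$ of positive operators is increasing if $P_{n+1}-P_n$ is positive for all $n$. The spectral bound is $s(A)=\sup\{\operatorname{Re}\lambda:\lambda\in\sigma(A)\}\in[-\infty,\infty]$, with $s(A)=-\infty$ if $\sigma(A)=\emptyset$. Let $(P_n)_{n\in\mathbb{N}}$ be an increasing sequence of positive operators on $E$ converging strongly to the identity. A $C_0$-semigroup $(e^{tA})_{t\ge 0}$ on $E$ has the LEP property with respect to $(P_n)$ if for every $n\in\mathbb{N}$ and $f\in E_+\setminus\{0\}$ there exists $\tau>0$ (depending on $n$ and $f$) such that $P_ne^{tA}f\ge 0$ for all $t\ge\tau$. It has the strong LEP property with respect to $(P_n)$ if in addition, for all $t\ge\tau$, $P_ne^{tA}f$ is a quasi-interior point of the closed sublattice of $E$ generated by $P_nE$. A positive element $u$ of a normed vector lattice $F$ is quasi-interior if the ideal of $F$ generated by $u$ is dense in $F$. *)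

theory Defs
  imports "HOL-Analysis.Analysis" "HOL-Library.Lattice_Algebras"
begin

section \<open>Real Banach lattices\<close>

class banach_lattice = banach + ordered_real_vector + lattice_ab_group_add_abs +
  assumes norm_abs_mono: "\<bar>x\<bar> \<le> \<bar>y\<bar> \<Longrightarrow> norm x \<le> norm y"

instance real :: banach_lattice
  by standard (auto simp: sup_real_def abs_if max_def)

lemma norm_mono_nonneg:
  fixes x y :: "'a::banach_lattice"
  assumes "0 \<le> x" "x \<le> y"
  shows "norm x \<le> norm y"
  using assms by (intro norm_abs_mono) (simp add: order_trans[OF assms])

lemma norm_abs_eq [simp]: "norm \<bar>x\<bar> = norm (x::'a::banach_lattice)"
  by (intro antisym norm_abs_mono) simp_all

lemma lim_nonneg:
  fixes X :: "nat \<Rightarrow> 'a::banach_lattice"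
  assumes lim: "X \<longlonglongrightarrow> x" and ev: "eventually (\<lambda>n. 0 \<le> X n) sequentially"
  shows "0 \<le> x"
proof -
  have "eventually (\<lambda>n. norm (sup (- x) 0) \<le> norm (X n - x)) sequentially"
    using ev
  proof eventually_elim
    case (elim n)
    have "- x \<le> X n - x" using elim by simp
    also have "\<dots> \<le> \<bar>X n - x\<bar>" by (rule abs_ge_self)
    finally have "sup (- x) 0 \<le> \<bar>X n - x\<bar>" by simp
    hence "norm (sup (- x) 0) \<le> norm \<bar>X n - x\<bar>" by (intro norm_mono_nonneg) auto
    thus ?case by simp
  qed
  moreover have "(\<lambda>n. norm (X n - x)) \<longlonglongrightarrow> 0"
    using lim by (simp add: LIM_zero tendsto_norm_zero)
  ultimately have "norm (sup (- x) 0) \<le> 0"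
    by (intro tendsto_lowerbound[of "\<lambda>n. norm (X n - x)"]) auto
  hence "sup (- x) 0 = 0" by simp
  hence "- x \<le> 0" by (metis sup_ge1)
  thus ?thesis by simp
qed

lemma lim_mono_bl:
  fixes X Y :: "nat \<Rightarrow> 'a::banach_lattice"
  assumes "X \<longlonglongrightarrow> x" "Y \<longlonglongrightarrow> y" "eventually (\<lambda>n. X n \<le> Y n) sequentially"
  shows "x \<le> y"
proof -
  have "0 \<le> y - x"
    by (rule lim_nonneg[OF tendsto_diff[OF assms(2,1)]]) (use assms(3) in simp)
  thus ?thesis by simp
qed

text \<open>An order-theoretically totally bounded set has a least upper bound.\<close>

lemma ex_lub_of_finite_nets:
  fixes S :: "'a::banach_lattice set"
  assumes ne: "S \<noteq> {}"
    and net: "\<And>e. (e::real) > 0 \<Longrightarrow>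
      \<exists>F. finite F \<and> F \<subseteq> S \<and> (\<forall>s\<in>S. \<exists>f\<in>F. s \<le> f + e *\<^sub>R u)"
    and u: "0 \<le> u"
  shows "\<exists>m. (\<forall>s\<in>S. s \<le> m) \<and> (\<forall>b. (\<forall>s\<in>S. s \<le> b) \<longrightarrow> m \<le> b)"
proof -
  define e :: "nat \<Rightarrow> real" where "e n = (1/2) ^ n" for n
  have epos: "e n > 0" for n by (simp add: e_def)
  have "\<forall>n. \<exists>F. finite F \<and> F \<subseteq> S \<and> (\<forall>s\<in>S. \<exists>f\<in>F. s \<le> f + e n *\<^sub>R u)"
    using net epos by blast
  then obtain F where F: "\<And>n. finite (F n)" "\<And>n. F n \<subseteq> S"
    "\<And>n s. s \<in> S \<Longrightarrow> \<exists>f\<in>F n. s \<le> f + e n *\<^sub>R u"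
    by metis
  define G where "G n = (\<Union>k\<le>n. F k)" for n
  have Gfin: "finite (G n)" for n using F(1) by (simp add: G_def)
  have Gsub: "G n \<subseteq> S" for n using F(2) by (auto simp: G_def)
  have Gne: "G n \<noteq> {}" for n using F(3) ne by (auto simp: G_def)
  have Gmono: "m \<le> n \<Longrightarrow> G m \<subseteq> G n" for m n by (fastforce simp: G_def)
  define t where "t n = Sup_fin (G n)" for n
  have t_ub: "s \<le> t n + e n *\<^sub>R u" if sS: "s \<in> S" for s n
  proof -
    obtain f where f: "f \<in> F n" "s \<le> f + e n *\<^sub>R u" using F(3)[OF sS] by blast
    have "f \<le> t n" unfolding t_def using f(1) Gfin by (intro Sup_fin.coboundedI) (auto simp: G_def)
    thus ?thesis using f(2) by (meson add_right_mono order_trans)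
  qed
  have t_least: "t n \<le> b" if "\<And>s. s \<in> S \<Longrightarrow> s \<le> b" for n b
    unfolding t_def by (rule Sup_fin.boundedI[OF Gfin Gne]) (use Gsub that in blast)
  have dist: "norm (t m - t n) \<le> e n * norm u" if "n \<le> m" for m n
  proof -
    have "t n \<le> t m" unfolding t_def
      using Gfin Gne Gmono[OF that] by (intro Sup_fin.subset_imp) auto
    moreover have "t m \<le> t n + e n *\<^sub>R u" by (rule t_least) (rule t_ub)
    ultimately have "norm (t m - t n) \<le> norm (e n *\<^sub>R u)"
      by (intro norm_mono_nonneg) (auto simp: algebra_simps)
    thus ?thesis using epos[of n] by simp
  qed
  have e0: "e \<longlonglongrightarrow> 0" unfolding e_def by (intro LIMSEQ_power_zero) simp
  have "Cauchy t"
  proof (rule CauchyI)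
    fix r :: real assume r: "r > 0"
    have "(\<lambda>n. e n * norm u) \<longlonglongrightarrow> 0" using tendsto_mult_right[OF e0, of "norm u"] by (simp add: mult.commute)
    hence "eventually (\<lambda>n. e n * norm u < r / 2) sequentially"
      using r by (intro order_tendstoD) auto
    then obtain N where N: "e N * norm u < r / 2" by (auto simp: eventually_sequentially)
    show "\<exists>M. \<forall>m\<ge>M. \<forall>n\<ge>M. norm (t m - t n) < r"
    proof (intro exI allI impI)
      fix m n assume "N \<le> m" "N \<le> n"
      hence "norm (t m - t N) < r/2" "norm (t n - t N) < r/2" using dist N by fastforce+
      moreover have "t m - t n = (t m - t N) - (t n - t N)" by simp
      ultimately show "norm (t m - t n) < r"
        by (smt (verit) norm_triangle_ineq4 field_sum_of_halves)
    qed
  qed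
  then obtain l where l: "t \<longlonglongrightarrow> l" by (auto simp: Cauchy_convergent_iff convergent_def)
  have lim: "(\<lambda>n. t n + e n *\<^sub>R u) \<longlonglongrightarrow> l"
    using tendsto_add[OF l tendsto_scaleR[OF e0 tendsto_const[of u]]] by simp
  have "s \<le> l" if "s \<in> S" for s
    by (rule lim_mono_bl[OF tendsto_const lim]) (use t_ub that in auto)
  moreover have "l \<le> b" if "\<And>s. s \<in> S \<Longrightarrow> s \<le> b" for b
    by (rule lim_mono_bl[OF l tendsto_const]) (use t_least that in auto)
  ultimately show ?thesis by blast
qed


section \<open>Complexification\<close>

text \<open>\<^term>\<open>Cplx x y\<close> stands for $x + iy$, so that \<open>'a complexification\<close> is the complex Banach
  lattice with real part \<open>'a\<close>.\<close>

datatype 'a complexification = Cplx (re_part: 'a) (im_part: 'a)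

lemma complexification_eqI:
  "re_part z = re_part w \<Longrightarrow> im_part z = im_part w \<Longrightarrow> z = w"
  by (cases z; cases w) simp

instantiation complexification :: (banach_lattice) real_vector
begin
definition "0 = Cplx 0 0"
definition "z + w = Cplx (re_part z + re_part w) (im_part z + im_part w)"
definition "- z = Cplx (- re_part z) (- im_part z)"
definition "z - w = Cplx (re_part z - re_part w) (im_part z - im_part w)"
definition "r *\<^sub>R z = Cplx (r *\<^sub>R re_part z) (r *\<^sub>R im_part z)"
instance
  by standard (auto simp: zero_complexification_def plus_complexification_def
      uminus_complexification_def minus_complexification_def scaleR_complexification_def
      algebra_simps)
end

lemma complexification_sel [simp]:
  fixes z w :: "'a::banach_lattice complexification"
  shows "re_part (0::'a complexification) = 0" "im_part (0::'a complexification) = 0"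
    "re_part (z + w) = re_part z + re_part w" "im_part (z + w) = im_part z + im_part w"
    "re_part (z - w) = re_part z - re_part w" "im_part (z - w) = im_part z - im_part w"
    "re_part (- z) = - re_part z" "im_part (- z) = - im_part z"
    "re_part (r *\<^sub>R z) = r *\<^sub>R re_part z" "im_part (r *\<^sub>R z) = r *\<^sub>R im_part z"
  by (simp_all add: zero_complexification_def plus_complexification_def
      uminus_complexification_def minus_complexification_def scaleR_complexification_def)

definition scaleC :: "complex \<Rightarrow> 'a::banach_lattice complexification \<Rightarrow> 'a complexification"
    (infixr \<open>*\<^sub>C\<close> 75) where
  "c *\<^sub>C z = Cplx (Re c *\<^sub>R re_part z - Im c *\<^sub>R im_part z) (Re c *\<^sub>R im_part z + Im c *\<^sub>R re_part z)"

lemma scaleC_sel [simp]: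
  "re_part (c *\<^sub>C z) = Re c *\<^sub>R re_part z - Im c *\<^sub>R im_part z"
  "im_part (c *\<^sub>C z) = Re c *\<^sub>R im_part z + Im c *\<^sub>R re_part z"
  by (simp_all add: scaleC_def)

lemma scaleC_add_right: "c *\<^sub>C (z + w) = c *\<^sub>C z + c *\<^sub>C w"
  by (rule complexification_eqI) (simp_all add: algebra_simps)

lemma scaleC_add_left: "(c + d) *\<^sub>C z = c *\<^sub>C z + d *\<^sub>C z"
  by (rule complexification_eqI) (simp_all add: algebra_simps)

lemma scaleC_scaleC: "c *\<^sub>C d *\<^sub>C z = (c * d) *\<^sub>C z"
  by (rule complexification_eqI) (simp_all add: algebra_simps)

lemma scaleC_one [simp]: "1 *\<^sub>C z = z"
  by (rule complexification_eqI) simp_all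

lemma scaleC_of_real: "complex_of_real r *\<^sub>C z = r *\<^sub>R z"
  by (rule complexification_eqI) simp_all

text \<open>The modulus $|z| = \sup_\theta \mathrm{Re}(e^{i\theta} z)$; the least upper bound exists by
  \<open>ex_modulus\<close> below.\<close>

definition modulus :: "'a::banach_lattice complexification \<Rightarrow> 'a" where
  "modulus z = (LEAST m. \<forall>\<theta>. re_part (cis \<theta> *\<^sub>C z) \<le> m)"

lemma scaleR_le_abs: "c *\<^sub>R x \<le> \<bar>c\<bar> *\<^sub>R \<bar>x :: 'a::banach_lattice\<bar>"
proof (cases "c \<ge> 0")
  case True
  thus ?thesis by (simp add: scaleR_left_mono abs_ge_self)
next
  case False
  have "(- c) *\<^sub>R (- x) \<le> (- c) *\<^sub>R \<bar>x\<bar>"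
    using False by (intro scaleR_left_mono) (auto simp: abs_ge_minus_self)
  thus ?thesis using False by simp
qed

lemma ex_modulus:
  "\<exists>m. (\<forall>\<theta>. re_part (cis \<theta> *\<^sub>C z) \<le> m) \<and>
       (\<forall>b. (\<forall>\<theta>. re_part (cis \<theta> *\<^sub>C z) \<le> b) \<longrightarrow> m \<le> b)"
proof -
  define u where "u = \<bar>re_part z\<bar> + \<bar>im_part z\<bar>"
  define g where "g c = re_part (c *\<^sub>C z)" for c
  have u0: "0 \<le> u" by (simp add: u_def)
  have lip: "g c \<le> g d + cmod (c - d) *\<^sub>R u" for c d
  proof -
    have "g c - g d = Re (c - d) *\<^sub>R re_part z + (- Im (c - d)) *\<^sub>R im_part z"
      by (simp add: g_def algebra_simps)
    also have "\<dots> \<le> \<bar>Re (c - d)\<bar> *\<^sub>R \<bar>re_part z\<bar> + \<bar>- Im (c - d)\<bar> *\<^sub>R \<bar>im_part z\<bar>"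
      by (intro add_mono scaleR_le_abs)
    also have "\<dots> \<le> cmod (c - d) *\<^sub>R \<bar>re_part z\<bar> + cmod (c - d) *\<^sub>R \<bar>im_part z\<bar>"
      by (intro add_mono scaleR_right_mono) (simp_all only: abs_minus_cancel abs_Re_le_cmod abs_Im_le_cmod abs_ge_zero)
    finally show ?thesis by (simp add: u_def algebra_simps)
  qed
  have range: "range (\<lambda>\<theta>. re_part (cis \<theta> *\<^sub>C z)) = g ` sphere 0 1"
  proof (intro set_eqI iffI)
    fix x assume "x \<in> g ` sphere 0 1"
    then obtain c where c: "cmod c = 1" "x = g c" by (auto simp: dist_norm)
    have "c = cis (Arg c)" using c(1) by (metis rcis_cmod_Arg rcis_def mult_1 of_real_1)
    show "x \<in> range (\<lambda>\<theta>. re_part (cis \<theta> *\<^sub>C z))"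
      by (rule range_eqI[of _ _ "Arg c"]) (simp only: c(2) g_def \<open>c = cis (Arg c)\<close>[symmetric])
  qed (auto simp: g_def simp del: scaleC_sel)
  have "\<exists>m. (\<forall>s\<in>g ` sphere 0 1. s \<le> m) \<and> (\<forall>b. (\<forall>s\<in>g ` sphere 0 1. s \<le> b) \<longrightarrow> m \<le> b)"
  proof (rule ex_lub_of_finite_nets[OF _ _ u0])
    show "g ` sphere 0 1 \<noteq> {}" unfolding range[symmetric] by simp
    fix e :: real assume e: "e > 0"
    obtain K where K: "K \<subseteq> sphere (0::complex) 1" "finite K" "sphere 0 1 \<subseteq> (\<Union>c\<in>K. ball c e)"
      by (rule compactE_image[OF compact_sphere, of "sphere (0::complex) 1" "\<lambda>c. ball c e"])
         (use e in auto)
    show "\<exists>F. finite F \<and> F \<subseteq> g ` sphere 0 1 \<and> (\<forall>s\<in>g ` sphere 0 1. \<exists>f\<in>F. s \<le> f + e *\<^sub>R u)"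
    proof (intro exI[of _ "g ` K"] conjI ballI)
      fix s assume "s \<in> g ` sphere 0 1"
      then obtain c where c: "c \<in> sphere 0 1" "s = g c" by blast
      then obtain d where d: "d \<in> K" "dist d c < e" using K(3) by auto
      have "s \<le> g d + cmod (c - d) *\<^sub>R u" using lip c by simp
      also have "\<dots> \<le> g d + e *\<^sub>R u"
        using d u0 by (intro add_left_mono scaleR_right_mono) (auto simp: dist_norm norm_minus_commute)
      finally show "\<exists>f\<in>g ` K. s \<le> f + e *\<^sub>R u" using d by blast
    qed (use K in auto)
  qed
  thus ?thesis unfolding range[symmetric] by (simp del: scaleC_sel)
qed

lemma modulus_lub:
  shows re_cis_le_modulus: "re_part (cis \<theta> *\<^sub>C z) \<le> modulus z"
    and modulus_least: "(\<And>\<theta>. re_part (cis \<theta> *\<^sub>C z) \<le> b) \<Longrightarrow> modulus z \<le> b"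
proof -
  obtain m where m: "\<forall>\<theta>. re_part (cis \<theta> *\<^sub>C z) \<le> m"
    "\<And>b. (\<forall>\<theta>. re_part (cis \<theta> *\<^sub>C z) \<le> b) \<Longrightarrow> m \<le> b"
    using ex_modulus[of z] by blast
  have "modulus z = m" unfolding modulus_def by (rule Least_equality) (use m in auto)
  thus "re_part (cis \<theta> *\<^sub>C z) \<le> modulus z"
    and "(\<And>\<theta>. re_part (cis \<theta> *\<^sub>C z) \<le> b) \<Longrightarrow> modulus z \<le> b"
    using m by auto
qed

lemma re_scaleC_le: "re_part (c *\<^sub>C z) \<le> cmod c *\<^sub>R modulus z"
proof -
  have c: "c = of_real (cmod c) * cis (Arg c)" by (metis rcis_cmod_Arg rcis_def)
  have "re_part (c *\<^sub>C z) = re_part (cmod c *\<^sub>R (cis (Arg c) *\<^sub>C z))"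
    by (subst c) (simp only: scaleC_scaleC[symmetric] scaleC_of_real)
  also have "\<dots> = cmod c *\<^sub>R re_part (cis (Arg c) *\<^sub>C z)"
    by (simp only: complexification_sel)
  also have "\<dots> \<le> cmod c *\<^sub>R modulus z"
    by (intro scaleR_left_mono re_cis_le_modulus) simp
  finally show ?thesis .
qed

lemma abs_re_le_modulus: "\<bar>re_part z\<bar> \<le> modulus z"
  and abs_im_le_modulus: "\<bar>im_part z\<bar> \<le> modulus z"
proof -
  show "\<bar>re_part z\<bar> \<le> modulus z"
    using re_scaleC_le[of 1 z] re_scaleC_le[of "-1" z] by (intro abs_leI) auto
  show "\<bar>im_part z\<bar> \<le> modulus z"
    using re_scaleC_le[of \<i> z] re_scaleC_le[of "-\<i>" z] by (intro abs_leI) auto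
qed

lemma modulus_nonneg [simp]: "0 \<le> modulus z"
  using abs_re_le_modulus[of z] abs_ge_zero order_trans by blast

lemma modulus_le: "modulus z \<le> \<bar>re_part z\<bar> + \<bar>im_part z\<bar>"
proof (rule modulus_least)
  fix \<theta>
  have "re_part (cis \<theta> *\<^sub>C z) = cos \<theta> *\<^sub>R re_part z + (- sin \<theta>) *\<^sub>R im_part z" by simp
  also have "\<dots> \<le> \<bar>cos \<theta>\<bar> *\<^sub>R \<bar>re_part z\<bar> + \<bar>- sin \<theta>\<bar> *\<^sub>R \<bar>im_part z\<bar>"
    by (intro add_mono scaleR_le_abs)
  also have "\<dots> \<le> 1 *\<^sub>R \<bar>re_part z\<bar> + 1 *\<^sub>R \<bar>im_part z\<bar>"
    by (intro add_mono scaleR_right_mono) auto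
  finally show "re_part (cis \<theta> *\<^sub>C z) \<le> \<bar>re_part z\<bar> + \<bar>im_part z\<bar>" by simp
qed

lemma modulus_of_real_part [simp]: "modulus (Cplx x 0) = \<bar>x\<bar>"
  using modulus_le[of "Cplx x 0"] abs_re_le_modulus[of "Cplx x 0"] by auto

lemma modulus_triangle: "modulus (z + w) \<le> modulus z + modulus w"
  by (rule modulus_least)
     (simp only: scaleC_add_right complexification_sel add_mono re_cis_le_modulus)

lemma modulus_scaleC: "modulus (c *\<^sub>C z) = cmod c *\<^sub>R modulus z"
proof (rule antisym)
  have le: "modulus (c *\<^sub>C z) \<le> cmod c *\<^sub>R modulus z" for c and z :: "'a complexification"
  proof (rule modulus_least)
    fix \<theta>
    have "re_part ((cis \<theta> * c) *\<^sub>C z) \<le> cmod (cis \<theta> * c) *\<^sub>R modulus z" by (rule re_scaleC_le)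
    thus "re_part (cis \<theta> *\<^sub>C c *\<^sub>C z) \<le> cmod c *\<^sub>R modulus z"
      by (simp only: scaleC_scaleC norm_mult norm_cis mult_1)
  qed
  show "modulus (c *\<^sub>C z) \<le> cmod c *\<^sub>R modulus z" by (rule le)
  show "cmod c *\<^sub>R modulus z \<le> modulus (c *\<^sub>C z)"
  proof (cases "c = 0")
    case False
    have "cmod c *\<^sub>R modulus (inverse c *\<^sub>C c *\<^sub>C z)
        \<le> cmod c *\<^sub>R (cmod (inverse c) *\<^sub>R modulus (c *\<^sub>C z))"
      by (intro scaleR_left_mono le) simp
    thus ?thesis using False by (simp add: scaleC_scaleC norm_inverse)
  qed simp
qed

instantiation complexification :: (banach_lattice) real_normed_vector
begin
definition "norm z = norm (modulus z)"
definition "dist (z :: 'a complexification) w = norm (z - w)"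
definition "sgn (z :: 'a complexification) = z /\<^sub>R norm z"
definition "uniformity =
  (INF e\<in>{0<..}. principal {(x, y). dist (x :: 'a complexification) y < e})"
definition "open (U :: 'a complexification set) \<longleftrightarrow>
  (\<forall>x\<in>U. eventually (\<lambda>(x', y). x' = x \<longrightarrow> y \<in> U) uniformity)"
instance
proof
  fix z w :: "'a complexification" and r :: real
  show "norm z = 0 \<longleftrightarrow> z = 0"
  proof
    assume "norm z = 0"
    hence "modulus z = 0" by (simp add: norm_complexification_def)
    hence "\<bar>re_part z\<bar> \<le> 0" "\<bar>im_part z\<bar> \<le> 0"
      using abs_re_le_modulus[of z] abs_im_le_modulus[of z] by simp_all
    thus "z = 0" by (intro complexification_eqI) auto
  qed (simp add: norm_complexification_def zero_complexification_def)
  have "norm (modulus (z + w)) \<le> norm (modulus z + modulus w)"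
    by (intro norm_mono_nonneg modulus_triangle) simp
  also have "\<dots> \<le> norm (modulus z) + norm (modulus w)" by (rule norm_triangle_ineq)
  finally show "norm (z + w) \<le> norm z + norm w" by (simp add: norm_complexification_def)
  show "norm (r *\<^sub>R z) = \<bar>r\<bar> * norm z"
    using modulus_scaleC[of "complex_of_real r" z]
    by (simp add: norm_complexification_def scaleC_of_real)
qed (simp_all add: dist_complexification_def sgn_complexification_def
    uniformity_complexification_def open_complexification_def)
end

lemma norm_scaleC: "norm (c *\<^sub>C z) = cmod c * norm z"
  by (simp add: norm_complexification_def modulus_scaleC)

lemma norm_of_real_part [simp]: "norm (Cplx x 0) = norm x"
  by (simp add: norm_complexification_def)

lemma norm_re_le: "norm (re_part z) \<le> norm z"
  and norm_im_le: "norm (im_part z) \<le> norm z"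
  unfolding norm_complexification_def
  using abs_re_le_modulus[of z] abs_im_le_modulus[of z] by (auto intro!: norm_abs_mono)

lemma norm_complexification_le: "norm z \<le> norm (re_part z) + norm (im_part z)"
proof -
  have "norm (modulus z) \<le> norm (\<bar>re_part z\<bar> + \<bar>im_part z\<bar>)"
    by (intro norm_mono_nonneg modulus_le) simp
  also have "\<dots> \<le> norm \<bar>re_part z\<bar> + norm \<bar>im_part z\<bar>" by (rule norm_triangle_ineq)
  finally show ?thesis by (simp add: norm_complexification_def)
qed

lemma bounded_linear_re_part: "bounded_linear re_part"
  by (rule bounded_linear_intro[where K = 1]) (simp_all add: norm_re_le)

lemma bounded_linear_im_part: "bounded_linear im_part"
  by (rule bounded_linear_intro[where K = 1]) (simp_all add: norm_im_le)

instance complexification :: (banach_lattice) banach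
proof
  fix X :: "nat \<Rightarrow> 'a complexification"
  assume "Cauchy X"
  hence "Cauchy (\<lambda>n. re_part (X n))" "Cauchy (\<lambda>n. im_part (X n))"
    using bounded_linear.Cauchy bounded_linear_re_part bounded_linear_im_part by blast+
  hence "convergent (\<lambda>n. re_part (X n))" "convergent (\<lambda>n. im_part (X n))"
    by (simp_all only: Cauchy_convergent)
  then obtain x y where x: "(\<lambda>n. re_part (X n)) \<longlonglongrightarrow> x" and y: "(\<lambda>n. im_part (X n)) \<longlonglongrightarrow> y"
    unfolding convergent_def by blast
  have "(\<lambda>n. re_part (X n) - x) \<longlonglongrightarrow> 0" "(\<lambda>n. im_part (X n) - y) \<longlonglongrightarrow> 0"
    using x y by (simp_all only: LIM_zero_iff)
  hence lim: "(\<lambda>n. norm (re_part (X n) - x) + norm (im_part (X n) - y)) \<longlonglongrightarrow> 0"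
    by (intro tendsto_add_zero tendsto_norm_zero)
  have "norm (X n - Cplx x y) \<le> norm (re_part (X n) - x) + norm (im_part (X n) - y)" for n
    using norm_complexification_le[of "X n - Cplx x y"] by simp
  hence "(\<lambda>n. X n - Cplx x y) \<longlonglongrightarrow> 0"
    by (intro Lim_null_comparison[OF _ lim] always_eventually allI)
  hence "X \<longlonglongrightarrow> Cplx x y" by (simp only: LIM_zero_iff)
  thus "convergent X" by (rule convergentI)
qed

definition real_part :: "'a::banach_lattice complexification set" where
  "real_part = {z. im_part z = 0}"

definition positive_cone :: "'a::banach_lattice complexification set" where
  "positive_cone = {z. im_part z = 0 \<and> 0 \<le> re_part z}"


section \<open>Operators\<close>

definition clinear ::
    "('a::banach_lattice complexification \<Rightarrow> 'a complexification) \<Rightarrow> bool" where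
  "clinear T \<longleftrightarrow> (\<forall>z w. T (z + w) = T z + T w) \<and> (\<forall>c z. T (c *\<^sub>C z) = c *\<^sub>C T z)"

definition bounded_clinear ::
    "('a::banach_lattice complexification \<Rightarrow> 'a complexification) \<Rightarrow> bool" where
  "bounded_clinear T \<longleftrightarrow> clinear T \<and> (\<exists>K. \<forall>z. norm (T z) \<le> K * norm z)"

definition positive_operator ::
    "('a::banach_lattice complexification \<Rightarrow> 'a complexification) \<Rightarrow> bool" where
  "positive_operator T \<longleftrightarrow> clinear T \<and> T ` positive_cone \<subseteq> positive_cone"

definition real_operator ::
    "('a::banach_lattice complexification \<Rightarrow> 'a complexification) \<Rightarrow> bool" where
  "real_operator T \<longleftrightarrow> clinear T \<and> T ` real_part \<subseteq> real_part"

definition lattice_homomorphism ::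
    "('a::banach_lattice complexification \<Rightarrow> 'a complexification) \<Rightarrow> bool" where
  "lattice_homomorphism T \<longleftrightarrow> real_operator T \<and>
    (\<forall>x y. re_part (T (Cplx (sup x y) 0)) = sup (re_part (T (Cplx x 0))) (re_part (T (Cplx y 0))) \<and>
           re_part (T (Cplx (inf x y) 0)) = inf (re_part (T (Cplx x 0))) (re_part (T (Cplx y 0))))"

definition increasing_operators ::
    "(nat \<Rightarrow> 'a::banach_lattice complexification \<Rightarrow> 'a complexification) \<Rightarrow> bool" where
  "increasing_operators P \<longleftrightarrow> (\<forall>n. positive_operator (\<lambda>f. P (Suc n) f - P n f))"

definition strongly_to_id ::
    "(nat \<Rightarrow> 'a::banach_lattice complexification \<Rightarrow> 'a complexification) \<Rightarrow> bool" where
  "strongly_to_id P \<longleftrightarrow> (\<forall>f. (\<lambda>n. P n f) \<longlonglongrightarrow> f)"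


section \<open>Semigroups, generators and spectra\<close>

definition C0_semigroup ::
    "(real \<Rightarrow> 'a::banach_lattice complexification \<Rightarrow> 'a complexification) \<Rightarrow> bool" where
  "C0_semigroup T \<longleftrightarrow>
    (\<forall>t\<ge>0. bounded_clinear (T t)) \<and>
    (\<forall>f. T 0 f = f) \<and>
    (\<forall>s\<ge>0. \<forall>t\<ge>0. \<forall>f. T (s + t) f = T s (T t f)) \<and>
    (\<forall>f. continuous_on {0..} (\<lambda>t. T t f))"

definition real_semigroup ::
    "(real \<Rightarrow> 'a::banach_lattice complexification \<Rightarrow> 'a complexification) \<Rightarrow> bool" where
  "real_semigroup T \<longleftrightarrow> (\<forall>t\<ge>0. real_operator (T t))"

text \<open>An unbounded operator is given by its domain together with a function, of which only the values
  on the domain matter.\<close>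

definition generator_domain ::
    "(real \<Rightarrow> 'a::banach_lattice complexification \<Rightarrow> 'a complexification) \<Rightarrow> 'a complexification set" where
  "generator_domain T = {f. \<exists>g. ((\<lambda>t. (T t f - f) /\<^sub>R t) \<longlongrightarrow> g) (at_right 0)}"

definition generator ::
    "(real \<Rightarrow> 'a::banach_lattice complexification \<Rightarrow> 'a complexification) \<Rightarrow>
     'a complexification \<Rightarrow> 'a complexification" where
  "generator T f = Lim (at_right 0) (\<lambda>t. (T t f - f) /\<^sub>R t)"

definition resolvent_set ::
    "'a::banach_lattice complexification set \<Rightarrow> ('a complexification \<Rightarrow> 'a complexification) \<Rightarrow> complex set" where
  "resolvent_set D A = {\<mu>. bij_betw (\<lambda>f. \<mu> *\<^sub>C f - A f) D UNIV \<and>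
     bounded_clinear (inv_into D (\<lambda>f. \<mu> *\<^sub>C f - A f))}"

definition spectrum ::
    "'a::banach_lattice complexification set \<Rightarrow> ('a complexification \<Rightarrow> 'a complexification) \<Rightarrow> complex set" where
  "spectrum D A = - resolvent_set D A"

definition point_spectrum ::
    "'a::banach_lattice complexification set \<Rightarrow> ('a complexification \<Rightarrow> 'a complexification) \<Rightarrow> complex set" where
  "point_spectrum D A = {\<mu>. \<exists>f\<in>D. f \<noteq> 0 \<and> A f = \<mu> *\<^sub>C f}"

text \<open>The supremum of the empty set is \<open>-\<infinity>\<close> in \<^typ>\<open>ereal\<close>. For the generator of a
  $C_0$-semigroup the spectral bound is never \<open>\<infinity>\<close>, so it is a real number as soon as it is
  not \<open>-\<infinity>\<close>.\<close>

definition spectral_bound ::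
    "'a::banach_lattice complexification set \<Rightarrow> ('a complexification \<Rightarrow> 'a complexification) \<Rightarrow> ereal" where
  "spectral_bound D A = (SUP \<mu>\<in>spectrum D A. ereal (Re \<mu>))"

text \<open>The semigroup $e^{t(A-\mu)} = e^{-t\mu}e^{tA}$ generated by $A - \mu$.\<close>

definition rescaled_semigroup ::
    "real \<Rightarrow> (real \<Rightarrow> 'a::banach_lattice complexification \<Rightarrow> 'a complexification) \<Rightarrow>
     real \<Rightarrow> 'a complexification \<Rightarrow> 'a complexification" where
  "rescaled_semigroup \<mu> T t f = exp (- (t * \<mu>)) *\<^sub>R T t f"

definition orbit :: "(real \<Rightarrow> 'b \<Rightarrow> 'b) \<Rightarrow> 'b \<Rightarrow> 'b set" where
  "orbit T f = {T t f | t. t \<ge> 0}"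


section \<open>Relative compactness\<close>

definition relatively_compact :: "'b::topological_space set \<Rightarrow> bool" where
  "relatively_compact S \<longleftrightarrow> compact (closure S)"

definition dual_space :: "('a::banach_lattice complexification \<Rightarrow> complex) set" where
  "dual_space = {\<phi>. (\<forall>z w. \<phi> (z + w) = \<phi> z + \<phi> w) \<and> (\<forall>c z. \<phi> (c *\<^sub>C z) = c * \<phi> z) \<and>
     (\<exists>K. \<forall>z. cmod (\<phi> z) \<le> K * norm z)}"

definition weak_topology :: "'a::banach_lattice complexification topology" where
  "weak_topology = topology_generated_by {\<phi> -` U | \<phi> U. \<phi> \<in> dual_space \<and> open U}"

lemma topspace_weak_topology [simp]:
  "topspace (weak_topology :: 'a::banach_lattice complexification topology) = UNIV"
proof -
  have "(\<lambda>_. 0) \<in> (dual_space :: ('a complexification \<Rightarrow> complex) set)"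
    unfolding dual_space_def by (simp add: exI[of _ 0])
  hence "UNIV \<in> {\<phi> -` U | \<phi> U. \<phi> \<in> (dual_space :: ('a complexification \<Rightarrow> complex) set) \<and> open U}"
    by (intro CollectI exI[of _ "\<lambda>_. 0"] exI[of _ UNIV]) simp
  thus ?thesis unfolding weak_topology_def topology_generated_by_topspace by (intro equalityI subset_UNIV Union_upper)
qed

definition relatively_weakly_compact :: "'a::banach_lattice complexification set \<Rightarrow> bool" where
  "relatively_weakly_compact S \<longleftrightarrow> compactin weak_topology (weak_topology closure_of S)"


section \<open>Sublattices, ideals and quasi-interior points\<close>

definition csubspace :: "'a::banach_lattice complexification set \<Rightarrow> bool" where
  "csubspace F \<longleftrightarrow> 0 \<in> F \<and> (\<forall>z\<in>F. \<forall>w\<in>F. z + w \<in> F) \<and> (\<forall>c. \<forall>z\<in>F. c *\<^sub>C z \<in> F)"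

text \<open>Sublattices of a complex Banach lattice are the complexifications $G + iG$ of the
  vector sublattices \<open>G\<close> of its real part.\<close>

definition vector_sublattice :: "'a::banach_lattice set \<Rightarrow> bool" where
  "vector_sublattice G \<longleftrightarrow> subspace G \<and> (\<forall>x\<in>G. \<forall>y\<in>G. sup x y \<in> G \<and> inf x y \<in> G)"

definition sublattice :: "'a::banach_lattice complexification set \<Rightarrow> bool" where
  "sublattice F \<longleftrightarrow> (\<exists>G. vector_sublattice G \<and> F = {z. re_part z \<in> G \<and> im_part z \<in> G})"

definition closed_sublattice_generated_by ::
    "'a::banach_lattice complexification set \<Rightarrow> 'a complexification set" where
  "closed_sublattice_generated_by S = (\<lambda>F. closed F \<and> sublattice F) hull S"

definition ideal_of ::
    "'a::banach_lattice complexification set \<Rightarrow> 'a complexification set \<Rightarrow> bool" where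
  "ideal_of F I \<longleftrightarrow> I \<subseteq> F \<and> csubspace I \<and> (\<forall>z\<in>F. \<forall>w\<in>I. modulus z \<le> modulus w \<longrightarrow> z \<in> I)"

definition quasi_interior_point ::
    "'a::banach_lattice complexification set \<Rightarrow> 'a complexification \<Rightarrow> bool" where
  "quasi_interior_point F u \<longleftrightarrow>
    u \<in> F \<inter> positive_cone \<and> F \<subseteq> closure (ideal_of F hull {u})"


section \<open>Local eventual positivity\<close>

definition LEP ::
    "(nat \<Rightarrow> 'a::banach_lattice complexification \<Rightarrow> 'a complexification) \<Rightarrow>
     (real \<Rightarrow> 'a complexification \<Rightarrow> 'a complexification) \<Rightarrow> bool" where
  "LEP P T \<longleftrightarrow> (\<forall>n. \<forall>f \<in> positive_cone - {0}. \<exists>\<tau>>0. \<forall>t\<ge>\<tau>. P n (T t f) \<in> positive_cone)"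

definition strong_LEP ::
    "(nat \<Rightarrow> 'a::banach_lattice complexification \<Rightarrow> 'a complexification) \<Rightarrow>
     (real \<Rightarrow> 'a complexification \<Rightarrow> 'a complexification) \<Rightarrow> bool" where
  "strong_LEP P T \<longleftrightarrow> (\<forall>n. \<forall>f \<in> positive_cone - {0}. \<exists>\<tau>>0. \<forall>t\<ge>\<tau>.
     P n (T t f) \<in> positive_cone \<and>
     quasi_interior_point (closed_sublattice_generated_by (range (P n))) (P n (T t f)))"

end

theory Submission
  imports Defs
begin

text \<open>(i) An increasing sequence of positive operators with strong limit $I$ satisfies
  $0 \le P_n \le I$, hence is uniformly bounded, and $P_n \to I$ uniformly on the relatively compact
  orbit of $f$; so $P_n e^{tA} f \in E_+$ is uniformly close to $e^{tA} f$ for a suitable $n$.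

  (ii) An eigenvalue $s(A) + i\beta$ with $\beta \ne 0$ yields a real $g \ne 0$ with
  $S_\sigma g = - g$, where $S_t = e^{t(A - s(A))}$ and $\sigma = \pi / |\beta|$. Weak limits of the
  iterates of $r = S_{2\sigma}$ along an ultrafilter define an operator $L$, which is positive by the
  LEP property; likewise let $N$ be the weak limit of the iterates of $L$. The sequence $L^k |g|$
  increases to the least $L$-fixed element $h = N|g|$ above $|g|$, and minimality forces $r h = h$. Then
  $a = h + g$ and $b = h - g$ are positive, $r$-periodic and nonzero, and $a \wedge b = h - |g|$ is
  annihilated by $N$. By the strong LEP property $Q_n a$ and $Q_n b$ are quasi-interior, while
  $N (Q_n a \wedge Q_n b) \le N (a \wedge b) = 0$. Hence $N Q_n = 0$ for all $n$, so $N = 0$,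
  contradicting $N g = g$.\<close>

section \<open>The Hahn-Banach theorem and ultrafilters\<close>

definition sublinear :: "('a::real_vector \<Rightarrow> real) \<Rightarrow> bool" where
  "sublinear q \<longleftrightarrow> (\<forall>x y. q (x + y) \<le> q x + q y) \<and> (\<forall>c\<ge>0. \<forall>x. q (c *\<^sub>R x) = c * q x)"

lemma sublinear_add: "sublinear q \<Longrightarrow> q (x + y) \<le> q x + q y"
  and sublinear_scale: "sublinear q \<Longrightarrow> 0 \<le> c \<Longrightarrow> q (c *\<^sub>R x) = c * q x"
  by (simp_all add: sublinear_def)

lemma sublinear_zero: "sublinear q \<Longrightarrow> q 0 = 0"
  using sublinear_scale[of q 0 0] by simp

lemma sublinear_ge: "sublinear q \<Longrightarrow> - q (- x) \<le> q x"
  using sublinear_add[of q x "- x"] sublinear_zero[of q] by simp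

text \<open>The inequality for c > 0 already forces equality: applied to \<open>inverse c\<close>
  and \<open>c *\<^sub>R x\<close> it gives the reverse bound.\<close>

lemma sublinearI:
  fixes q :: "'a::real_vector \<Rightarrow> real"
  assumes add: "\<And>x y. q (x + y) \<le> q x + q y" and zero: "q 0 = 0"
    and scale: "\<And>c x. 0 < c \<Longrightarrow> q (c *\<^sub>R x) \<le> c * q x"
  shows "sublinear q"
  unfolding sublinear_def
proof (intro conjI allI impI add)
  fix c :: real and x assume "0 \<le> c"
  show "q (c *\<^sub>R x) = c * q x"
  proof (cases "c = 0")
    case False
    hence c: "0 < c" using \<open>0 \<le> c\<close> by simp
    have "q (inverse c *\<^sub>R (c *\<^sub>R x)) \<le> inverse c * q (c *\<^sub>R x)" using c by (intro scale) simp
    hence "c * q x \<le> q (c *\<^sub>R x)" using c by (simp add: field_simps)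
    thus ?thesis using scale[OF c, of x] by simp
  qed (simp add: zero)
qed

text \<open>An auxiliary functional of the Hahn-Banach argument: for sublinear \<open>q\<close> it
  lies below \<open>q\<close> (t = 0) and is at most \<open>- q y\<close> at \<open>- y\<close> (t =
  1).\<close>

definition sublinear_shift :: "('a::real_vector \<Rightarrow> real) \<Rightarrow> 'a \<Rightarrow> 'a \<Rightarrow> real" where
  "sublinear_shift q y x = (INF t\<in>{0..}. q (x + t *\<^sub>R y) - t * q y)"

text \<open>The infimum is finite, since t q(y) = q(t y) \<le> q(x + t y) + q(-x) bounds the family
  below by -q(-x).\<close>

lemma sublinear_shift_le:
  assumes q: "sublinear q" and t: "0 \<le> t"
  shows "sublinear_shift q y x \<le> q (x + t *\<^sub>R y) - t * q y"
  unfolding sublinear_shift_def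
proof (rule cINF_lower)
  show "bdd_below ((\<lambda>t. q (x + t *\<^sub>R y) - t * q y) ` {0..})"
  proof (rule bdd_belowI2)
    fix s :: real assume "s \<in> {0..}"
    thus "- q (- x) \<le> q (x + s *\<^sub>R y) - s * q y"
      using sublinear_add[OF q, of "x + s *\<^sub>R y" "- x"] sublinear_scale[OF q, of s y] by simp
  qed
qed (use t in simp)

lemma sublinear_shift_greatest:
  assumes "\<And>t. 0 \<le> t \<Longrightarrow> b \<le> q (x + t *\<^sub>R y) - t * q y"
  shows "b \<le> sublinear_shift q y x"
  unfolding sublinear_shift_def using assms by (intro cINF_greatest) auto

text \<open>Parameters \<open>s\<close> and \<open>t\<close> for two summands combine to
  \<open>s + t\<close> for the sum; scaling the vector by \<open>c\<close> scales the parameter by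
  \<open>c\<close>.\<close>

lemma sublinear_sublinear_shift:
  assumes q: "sublinear q"
  shows "sublinear (sublinear_shift q y)"
proof (rule sublinearI)
  fix x x' :: 'a
  have *: "sublinear_shift q y (x + x')
    \<le> (q (x + s *\<^sub>R y) - s * q y) + (q (x' + t *\<^sub>R y) - t * q y)" if "0 \<le> s" "0 \<le> t" for s t
    using sublinear_shift_le[OF q, of "s + t" y "x + x'"] that
      sublinear_add[OF q, of "x + s *\<^sub>R y" "x' + t *\<^sub>R y"] by (simp add: algebra_simps)
  have "sublinear_shift q y (x + x') - (q (x + s *\<^sub>R y) - s * q y) \<le> sublinear_shift q y x'"
    if "0 \<le> s" for s
    by (rule sublinear_shift_greatest) (use *[OF that] in \<open>simp add: algebra_simps\<close>)
  hence "sublinear_shift q y (x + x') - sublinear_shift q y x' \<le> sublinear_shift q y x"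
    by (intro sublinear_shift_greatest) (simp add: algebra_simps)
  thus "sublinear_shift q y (x + x') \<le> sublinear_shift q y x + sublinear_shift q y x'" by simp
next
  show "sublinear_shift q y 0 = 0"
  proof (rule antisym)
    show "sublinear_shift q y 0 \<le> 0"
      using sublinear_shift_le[OF q, of 0 y 0] sublinear_zero[OF q] by simp
    show "0 \<le> sublinear_shift q y 0"
      by (rule sublinear_shift_greatest) (simp add: sublinear_scale[OF q])
  qed
next
  fix c :: real and x :: 'a assume c: "0 < c"
  have "sublinear_shift q y (c *\<^sub>R x) / c \<le> sublinear_shift q y x"
  proof (rule sublinear_shift_greatest)
    fix t :: real assume t: "0 \<le> t"
    have "sublinear_shift q y (c *\<^sub>R x) \<le> q (c *\<^sub>R (x + t *\<^sub>R y)) - c * t * q y"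
      using sublinear_shift_le[OF q, of "c * t" y "c *\<^sub>R x"] c t by (simp add: algebra_simps)
    also have "\<dots> = (q (x + t *\<^sub>R y) - t * q y) * c"
      using c by (subst sublinear_scale[OF q]) (simp_all add: algebra_simps)
    finally show "sublinear_shift q y (c *\<^sub>R x) / c \<le> q (x + t *\<^sub>R y) - t * q y"
      using c by (simp add: field_simps)
  qed
  thus "sublinear_shift q y (c *\<^sub>R x) \<le> c * sublinear_shift q y x"
    using c by (simp add: field_simps)
qed

text \<open>This supplies the bound of a chain in Zorn's lemma. The infimum is finite because q(x)
  \<ge> -q(-x) \<ge> -p(-x). For subadditivity, two members \<open>q\<close> and \<open>r\<close> of
  the chain are replaced by the smaller of them.\<close>

lemma sublinear_chain_Inf:
  fixes p :: "'a::real_vector \<Rightarrow> real"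
  assumes sub: "\<And>q. q \<in> C \<Longrightarrow> sublinear q" and le: "\<And>q x. q \<in> C \<Longrightarrow> q x \<le> p x"
    and ne: "C \<noteq> {}" and chain: "\<forall>q\<in>C. \<forall>r\<in>C. q \<le> r \<or> r \<le> q"
  shows "sublinear (\<lambda>x. INF q\<in>C. q x)" and "\<And>q x. q \<in> C \<Longrightarrow> (INF q\<in>C. q x) \<le> q x"
proof -
  have bdd: "bdd_below ((\<lambda>q. q x) ` C)" for x
  proof (rule bdd_belowI2)
    fix q assume "q \<in> C"
    thus "- p (- x) \<le> q x" using sublinear_ge[OF sub, of q x] le[of q "- x"] by simp
  qed
  show low: "(INF q\<in>C. q x) \<le> q x" if "q \<in> C" for q x
    by (rule cINF_lower[OF bdd that])
  show "sublinear (\<lambda>x. INF q\<in>C. q x)"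
  proof (rule sublinearI)
    fix x y
    have *: "(INF q\<in>C. q (x + y)) \<le> q x + r y" if qr: "q \<in> C" "r \<in> C" for q r
    proof -
      obtain m where m: "m \<in> C" "m \<le> q" "m \<le> r" using chain qr by blast
      have "(INF q\<in>C. q (x + y)) \<le> m (x + y)" by (rule low[OF m(1)])
      also have "\<dots> \<le> m x + m y" by (rule sublinear_add[OF sub[OF m(1)]])
      also have "\<dots> \<le> q x + r y" using m by (intro add_mono) (auto simp: le_fun_def)
      finally show ?thesis .
    qed
    have "(INF q\<in>C. q (x + y)) - q x \<le> (INF r\<in>C. r y)" if "q \<in> C" for q
      by (rule cINF_greatest[OF ne]) (use *[OF that] in \<open>simp add: algebra_simps\<close>)
    hence "(INF q\<in>C. q (x + y)) - (INF r\<in>C. r y) \<le> (INF q\<in>C. q x)"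
      by (intro cINF_greatest[OF ne]) (simp add: algebra_simps)
    thus "(INF q\<in>C. q (x + y)) \<le> (INF q\<in>C. q x) + (INF q\<in>C. q y)" by simp
  next
    have "q 0 = 0" if "q \<in> C" for q using sublinear_zero[OF sub[OF that]] .
    hence "(\<lambda>q. q 0) ` C = {0}" using ne by force
    thus "(INF q\<in>C. q 0) = 0" by simp
  next
    fix c :: real and x assume c: "0 < c"
    have "(INF q\<in>C. q (c *\<^sub>R x)) / c \<le> (INF q\<in>C. q x)"
    proof (rule cINF_greatest[OF ne])
      fix q assume q: "q \<in> C"
      have "(INF q\<in>C. q (c *\<^sub>R x)) \<le> c * q x"
        using low[OF q, of "c *\<^sub>R x"] sublinear_scale[OF sub[OF q], of c x] c by simp
      thus "(INF q\<in>C. q (c *\<^sub>R x)) / c \<le> q x" using c by (simp add: field_simps)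
    qed
    thus "(INF q\<in>C. q (c *\<^sub>R x)) \<le> c * (INF q\<in>C. q x)" using c by (simp add: field_simps)
  qed
qed

text \<open>A minimal sublinear functional coincides with all its shifts, which makes it additive.\<close>

lemma ex_linear_le_sublinear:
  fixes p :: "'a::real_vector \<Rightarrow> real"
  assumes p: "sublinear p"
  shows "\<exists>\<phi>. linear \<phi> \<and> (\<forall>x. \<phi> x \<le> p x)"
proof -
  define A where "A = {q. sublinear q \<and> q \<le> p}"
  \<comment> \<open>The order is reversed, so that the maximal element delivered by Zorn's lemma is
    a minimal sublinear functional.\<close>
  define P :: "('a \<Rightarrow> real) \<Rightarrow> ('a \<Rightarrow> real) \<Rightarrow> bool" where "P a b \<longleftrightarrow> b \<le> a" for a b
  have "\<exists>m\<in>A. \<forall>a\<in>A. P m a \<longrightarrow> a = m"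
  proof (rule predicate_Zorn)
    show "partial_order_on A (relation_of P A)"
      by (intro partial_order_on_relation_ofI) (auto simp: P_def)
  next
    fix C assume "C \<in> Chains (relation_of P A)"
    hence C: "C \<subseteq> A" and chain: "\<forall>q\<in>C. \<forall>r\<in>C. q \<le> r \<or> r \<le> q"
      by (auto simp: Chains_def relation_of_def P_def)
    show "\<exists>u\<in>A. \<forall>a\<in>C. P a u"
    proof (cases "C = {}")
      case True
      thus ?thesis using p by (auto simp: A_def)
    next
      case False
      have sub: "\<And>q. q \<in> C \<Longrightarrow> sublinear q" and le: "\<And>q x. q \<in> C \<Longrightarrow> q x \<le> p x"
        using C by (auto simp: A_def le_fun_def)
      have inf: "sublinear (\<lambda>x. INF q\<in>C. q x)" "\<And>q x. q \<in> C \<Longrightarrow> (INF q\<in>C. q x) \<le> q x"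
      proof (rule sublinear_chain_Inf[where C = C and p = p])
        fix q x assume q: "q \<in> C"
        show "(INF q\<in>C. q x) \<le> q x"
          by (rule sublinear_chain_Inf(2)[where C = C and p = p, OF _ _ False chain q]) (use sub le in auto)
      qed (use sub le False chain in auto)
      have "(\<lambda>x. INF q\<in>C. q x) \<le> p"
      proof (rule le_funI)
        fix x
        obtain q where q: "q \<in> C" using False by blast
        show "(INF q\<in>C. q x) \<le> p x" using inf(2)[OF q, of x] le[OF q, of x] by simp
      qed
      thus ?thesis using inf
        by (intro bexI[of _ "\<lambda>x. INF q\<in>C. q x"]) (auto simp: A_def P_def le_fun_def)
    qed
  qed
  then obtain m where m: "m \<in> A" "\<And>a. a \<in> A \<Longrightarrow> a \<le> m \<Longrightarrow> a = m" by (auto simp: P_def)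
  have sub: "sublinear m" and le: "m \<le> p" using m(1) by (auto simp: A_def)
  have shift_le: "sublinear_shift m y \<le> m" for y
    using sublinear_shift_le[OF sub, of 0] by (simp add: le_fun_def)
  hence shift: "sublinear_shift m y = m" for y
    using le sublinear_sublinear_shift[OF sub] by (intro m(2)) (auto simp: A_def intro: order_trans)
  have add: "m (x + y) = m x + m y" for x y
  proof (rule antisym)
    show "m x + m y \<le> m (x + y)"
      using sublinear_shift_le[OF sub, of 1 y x] by (simp add: shift)
  qed (rule sublinear_add[OF sub])
  have neg: "m (- x) = - m x" for x
    using add[of x "- x"] sublinear_zero[OF sub] by simp
  have "linear m"
  proof (rule linearI)
    fix c x
    show "m (c *\<^sub>R x) = c *\<^sub>R m x"
      using sublinear_scale[OF sub, of c x] sublinear_scale[OF sub, of "- c" x] neg[of "c *\<^sub>R x"]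
      by (cases "0 \<le> c") auto
  qed (rule add)
  thus ?thesis using le by (auto simp: le_fun_def)
qed

text \<open>A linear functional below the shift of \<open>p\<close> by \<open>y\<close> is at most
  \<open>- p y\<close> at \<open>- y\<close>, hence attains \<open>p\<close> at
  \<open>y\<close>.\<close>

theorem Hahn_Banach_sublinear:
  fixes p :: "'a::real_vector \<Rightarrow> real"
  assumes p: "sublinear p"
  shows "\<exists>\<phi>. linear \<phi> \<and> (\<forall>x. \<phi> x \<le> p x) \<and> \<phi> y = p y"
proof -
  obtain \<phi> where \<phi>: "linear \<phi>" "\<And>x. \<phi> x \<le> sublinear_shift p y x"
    using ex_linear_le_sublinear[OF sublinear_sublinear_shift[OF p]] by blast
  have le: "\<phi> x \<le> p x" for x
    using \<phi>(2)[of x] sublinear_shift_le[OF p, of 0 y x] by simp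
  have "\<phi> (- y) \<le> - p y"
    using \<phi>(2)[of "- y"] sublinear_shift_le[OF p, of 1 y "- y"] sublinear_zero[OF p] by simp
  hence "p y \<le> \<phi> y" using linear_neg[OF \<phi>(1)] by simp
  thus ?thesis using \<phi>(1) le by (intro exI[of _ \<phi>]) (auto intro: antisym)
qed

section \<open>Ultrafilters and limits in compact sets\<close>

text \<open>Zorn's lemma for the proper filters below \<open>F\<close>: restricting a minimal one to
  a set either gives \<open>bot\<close> or changes nothing, so every predicate is decided.\<close>

lemma ex_ultrafilter:
  fixes F :: "'a filter"
  assumes F: "F \<noteq> bot"
  shows "\<exists>U\<le>F. U \<noteq> bot \<and> (\<forall>P. eventually P U \<or> eventually (\<lambda>x. \<not> P x) U)"
proof -
  define A where "A = {G. G \<noteq> bot \<and> G \<le> F}"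
  define R :: "'a filter \<Rightarrow> 'a filter \<Rightarrow> bool" where "R a b \<longleftrightarrow> b \<le> a" for a b
  have "\<exists>m\<in>A. \<forall>a\<in>A. R m a \<longrightarrow> a = m"
  proof (rule predicate_Zorn)
    show "partial_order_on A (relation_of R A)"
      by (intro partial_order_on_relation_ofI) (auto simp: R_def)
  next
    fix C assume "C \<in> Chains (relation_of R A)"
    hence C: "C \<subseteq> A" and chain: "\<forall>q\<in>C. \<forall>r\<in>C. q \<le> r \<or> r \<le> q"
      by (auto simp: Chains_def relation_of_def R_def)
    show "\<exists>u\<in>A. \<forall>a\<in>C. R a u"
    proof (cases "C = {}")
      case True
      thus ?thesis using F by (auto simp: A_def)
    next
      case False
      \<comment> \<open>What holds eventually for the infimum of a chain holds eventually for some
        member, so the infimum is proper.\<close>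
      have "eventually P (Inf C) \<longleftrightarrow> (\<exists>b\<in>C. eventually P b)" for P
      proof (rule eventually_Inf_base[OF False])
        fix G H assume "G \<in> C" "H \<in> C"
        thus "\<exists>x\<in>C. x \<le> inf G H" using chain by (metis inf.idem inf_absorb1 inf_absorb2 order_refl)
      qed
      hence "Inf C \<noteq> bot" using C by (auto simp: trivial_limit_def A_def)
      moreover have "Inf C \<le> F" using False C by (auto simp: A_def intro: Inf_lower2)
      ultimately show ?thesis
        by (intro bexI[of _ "Inf C"]) (auto simp: A_def R_def Inf_lower)
    qed
  qed
  then obtain U where U: "U \<in> A" "\<And>a. a \<in> A \<Longrightarrow> a \<le> U \<Longrightarrow> a = U" by (auto simp: R_def)
  have "eventually P U \<or> eventually (\<lambda>x. \<not> P x) U" for P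
  proof (cases "inf U (principal {x. P x}) = bot")
    case True
    thus ?thesis by (simp add: trivial_limit_def eventually_inf_principal)
  next
    case False
    hence "inf U (principal {x. P x}) = U"
      using U(1) by (intro U(2)) (auto simp: A_def intro: le_infI1)
    moreover have "eventually P (inf U (principal {x. P x}))"
      by (simp add: eventually_inf_principal)
    ultimately show ?thesis by simp
  qed
  thus ?thesis using U(1) by (auto simp: A_def)
qed

text \<open>If no point of \<open>K\<close> were a limit, each would have an open neighbourhood
  avoided by the ultrafilter, and a finite subcover would make it improper. One ultrafilter serves
  all vectors at once, which is what makes the limit operators below linear.\<close>

lemma compactin_ultrafilter_limit:
  assumes K: "compactin X K" and U: "U \<noteq> bot"
    and ultra: "\<And>P. eventually P U \<or> eventually (\<lambda>x. \<not> P x) U"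
    and f: "\<And>i. f i \<in> K"
  shows "\<exists>y\<in>K. limitin X f y U"
proof (rule ccontr)
  assume no: "\<not> ?thesis"
  have "\<exists>V. openin X V \<and> y \<in> V \<and> eventually (\<lambda>i. f i \<notin> V) U" if y: "y \<in> K" for y
  proof -
    have "y \<in> topspace X" using compactin_subset_topspace[OF K] y by blast
    then obtain V where V: "openin X V" "y \<in> V" "\<not> eventually (\<lambda>i. f i \<in> V) U"
      using no y by (auto simp: limitin_def)
    thus ?thesis using ultra[of "\<lambda>i. f i \<in> V"] by auto
  qed
  then obtain V where V: "\<And>y. y \<in> K \<Longrightarrow> openin X (V y)" "\<And>y. y \<in> K \<Longrightarrow> y \<in> V y"
    "\<And>y. y \<in> K \<Longrightarrow> eventually (\<lambda>i. f i \<notin> V y) U"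
    by metis
  have "(\<forall>W\<in>V ` K. openin X W) \<and> K \<subseteq> \<Union>(V ` K)" using V(1,2) by blast
  then obtain F where F: "finite F" "F \<subseteq> V ` K" "K \<subseteq> \<Union>F"
    using K unfolding compactin_def by meson
  have "eventually (\<lambda>i. \<forall>W\<in>F. f i \<notin> W) U"
    using F(1,2) V(3) by (subst eventually_ball_finite_distrib) auto
  hence "eventually (\<lambda>i. False) U" by eventually_elim (use F(3) f in blast)
  thus False using U by (simp add: trivial_limit_def)
qed


section \<open>Weak convergence in a Banach lattice\<close>

text \<open>Weak convergence tested by real functionals, for use in the real part;
  \<open>limitin_weak_topology_wlim\<close> links it to the weak topology of the
  complexification.\<close>

definition wlim :: "'i filter \<Rightarrow> ('i \<Rightarrow> 'a::real_normed_vector) \<Rightarrow> 'a \<Rightarrow> bool" where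
  "wlim F X x \<longleftrightarrow> (\<forall>\<phi>. bounded_linear \<phi> \<longrightarrow> ((\<lambda>i. \<phi> (X i) :: real) \<longlongrightarrow> \<phi> x) F)"

lemma wlim_const: "wlim F (\<lambda>_. x) x"
  by (simp add: wlim_def)

lemma wlim_add: "wlim F X x \<Longrightarrow> wlim F Y y \<Longrightarrow> wlim F (\<lambda>i. X i + Y i) (x + y)"
  unfolding wlim_def by (auto simp: linear_add[OF bounded_linear.linear] intro!: tendsto_add)

lemma wlim_diff: "wlim F X x \<Longrightarrow> wlim F Y y \<Longrightarrow> wlim F (\<lambda>i. X i - Y i) (x - y)"
  unfolding wlim_def by (auto simp: linear_diff[OF bounded_linear.linear] intro!: tendsto_diff)

lemma wlim_bounded_linear:
  assumes "bounded_linear f" "wlim F X x"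
  shows "wlim F (\<lambda>i. f (X i)) (f x)"
  unfolding wlim_def
proof (intro allI impI)
  fix \<phi> :: "'b \<Rightarrow> real" assume "bounded_linear \<phi>"
  hence "bounded_linear (\<lambda>x. \<phi> (f x))" by (rule bounded_linear_compose[OF _ assms(1)])
  thus "((\<lambda>i. \<phi> (f (X i))) \<longlongrightarrow> \<phi> (f x)) F" using assms(2)[unfolded wlim_def, rule_format] by blast
qed

section \<open>Positive functionals and order under weak limits\<close>

lemma norm_sup_zero_add:
  fixes x y :: "'a::banach_lattice"
  shows "norm (sup (x + y) 0) \<le> norm (sup x 0) + norm (sup y 0)"
proof -
  have "sup (x + y) 0 \<le> sup x 0 + sup y 0" by (intro sup_least add_mono) auto
  hence "norm (sup (x + y) 0) \<le> norm (sup x 0 + sup y 0)" by (intro norm_mono_nonneg) auto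
  also have "\<dots> \<le> norm (sup x 0) + norm (sup y 0)" by (rule norm_triangle_ineq)
  finally show ?thesis .
qed

lemma scaleR_sup_zero:
  fixes x :: "'a::banach_lattice"
  assumes "0 \<le> c"
  shows "sup (c *\<^sub>R x) 0 = c *\<^sub>R sup x 0"
proof (cases "c = 0")
  case False
  hence c: "0 < c" using assms by simp
  show ?thesis
  proof (rule antisym)
    show "sup (c *\<^sub>R x) 0 \<le> c *\<^sub>R sup x 0"
      using assms by (intro sup_least scaleR_left_mono scaleR_nonneg_nonneg) auto
    have "inverse c *\<^sub>R (c *\<^sub>R x) \<le> inverse c *\<^sub>R sup (c *\<^sub>R x) 0"
      using c by (intro scaleR_left_mono) auto
    moreover have "0 \<le> inverse c *\<^sub>R sup (c *\<^sub>R x) 0" using c by (intro scaleR_nonneg_nonneg) auto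
    ultimately have "sup x 0 \<le> inverse c *\<^sub>R sup (c *\<^sub>R x) 0" using c by simp
    hence "c *\<^sub>R sup x 0 \<le> c *\<^sub>R (inverse c *\<^sub>R sup (c *\<^sub>R x) 0)"
      using c by (intro scaleR_left_mono) auto
    thus "c *\<^sub>R sup x 0 \<le> sup (c *\<^sub>R x) 0" using c by simp
  qed
qed simp

text \<open>Hahn-Banach is applied to the sublinear functional $x \mapsto \|x^+\|$, which vanishes on the
  negative cone.\<close>

lemma ex_positive_functional:
  fixes x :: "'a::banach_lattice"
  assumes "\<not> 0 \<le> x"
  shows "\<exists>\<phi>. bounded_linear \<phi> \<and> (\<forall>y\<ge>0. (0::real) \<le> \<phi> y) \<and> \<phi> x < 0"
proof -
  define p :: "'a \<Rightarrow> real" where "p y = norm (sup y 0)" for y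
  have p: "sublinear p"
    unfolding sublinear_def p_def by (simp add: norm_sup_zero_add scaleR_sup_zero)
  \<comment> \<open>The value is prescribed at \<open>- x\<close>, where \<open>p\<close> is the
    norm of the negative part of \<open>x\<close> and hence positive.\<close>
  obtain \<phi> where \<phi>: "linear \<phi>" "\<And>y. \<phi> y \<le> p y" "\<phi> (- x) = p (- x)"
    using Hahn_Banach_sublinear[OF p, of "- x"] by blast
  have p_le: "p y \<le> norm y" for y
  proof -
    have "sup y 0 \<le> \<bar>y\<bar>" by (intro sup_least abs_ge_self abs_ge_zero)
    hence "p y \<le> norm \<bar>y\<bar>" unfolding p_def by (intro norm_mono_nonneg) auto
    thus ?thesis by simp
  qed
  have neg: "\<phi> (- y) = - \<phi> y" for y by (rule linear_neg[OF \<phi>(1)])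
  have "norm (\<phi> y) \<le> norm y * 1" for y
    using \<phi>(2)[of y] \<phi>(2)[of "- y"] p_le[of y] p_le[of "- y"] neg[of y] by simp
  hence bl: "bounded_linear \<phi>" using \<phi>(1)
    by (intro bounded_linear_intro[where K = 1]) (auto simp: linear_add linear_scale)
  have pos: "0 \<le> \<phi> y" if "0 \<le> y" for y
  proof -
    have "p (- y) = 0" using that unfolding p_def by (simp add: sup_absorb2)
    thus ?thesis using \<phi>(2)[of "- y"] neg[of y] by simp
  qed
  have "sup (- x) 0 \<noteq> 0" using assms by (metis neg_le_0_iff_le sup_ge1)
  hence "0 < p (- x)" by (simp add: p_def)
  thus ?thesis using bl pos \<phi>(3) neg[of x] by (intro exI[of _ \<phi>]) auto
qed

text \<open>The positive cone is weakly closed: a positive functional negative at \<open>x\<close>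
  would be nonnegative along \<open>X\<close>.\<close>

lemma wlim_nonneg:
  fixes x :: "'a::banach_lattice"
  assumes lim: "wlim F X x" and F: "F \<noteq> bot" and ev: "eventually (\<lambda>i. 0 \<le> X i) F"
  shows "0 \<le> x"
proof (rule ccontr)
  assume "\<not> 0 \<le> x"
  then obtain \<phi> where \<phi>: "bounded_linear \<phi>" "\<And>y. 0 \<le> y \<Longrightarrow> (0::real) \<le> \<phi> y" "\<phi> x < 0"
    using ex_positive_functional by blast
  have "((\<lambda>i. \<phi> (X i)) \<longlongrightarrow> \<phi> x) F" using lim \<phi>(1) by (simp add: wlim_def)
  moreover have "eventually (\<lambda>i. 0 \<le> \<phi> (X i)) F" using ev by eventually_elim (rule \<phi>(2))
  ultimately have "0 \<le> \<phi> x" by (rule tendsto_lowerbound[OF _ _ F])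
  thus False using \<phi>(3) by simp
qed

lemma wlim_mono:
  fixes x y :: "'a::banach_lattice"
  assumes "wlim F X x" "wlim F Y y" "F \<noteq> bot" "eventually (\<lambda>i. X i \<le> Y i) F"
  shows "x \<le> y"
  using wlim_nonneg[OF wlim_diff[OF assms(2,1)] assms(3)] assms(4) by simp

lemma wlim_unique:
  fixes x y :: "'a::banach_lattice"
  assumes "wlim F X x" "wlim F X y" "F \<noteq> bot"
  shows "x = y"
  using wlim_mono[OF assms] wlim_mono[OF assms(2,1,3)] by (auto intro: antisym)


section \<open>Positive operators on a Banach lattice\<close>

lemma positive_linear_mono:
  fixes f :: "'a::banach_lattice \<Rightarrow> 'b::banach_lattice"
  assumes "linear f" "\<And>x. 0 \<le> x \<Longrightarrow> 0 \<le> f x" "x \<le> y"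
  shows "f x \<le> f y"
  using assms(2)[of "y - x"] assms(3) by (simp add: linear_diff[OF assms(1)])

lemma positive_linear_abs_le:
  fixes f :: "'a::banach_lattice \<Rightarrow> 'b::banach_lattice"
  assumes "linear f" "\<And>x. 0 \<le> x \<Longrightarrow> 0 \<le> f x"
  shows "\<bar>f x\<bar> \<le> f \<bar>x\<bar>"
proof (rule abs_leI)
  show "f x \<le> f \<bar>x\<bar>" by (rule positive_linear_mono[OF assms abs_ge_self])
  have "f (- x) \<le> f \<bar>x\<bar>" by (rule positive_linear_mono[OF assms abs_ge_minus_self])
  thus "- f x \<le> f \<bar>x\<bar>" by (simp add: linear_neg[OF assms(1)])
qed

text \<open>Automatic continuity: if $x_k \ge 0$ has norm at most $2^{-k}$ and $\|f x_k\| > k$, then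
  $f(\sum_k x_k)$ dominates every $f x_k$.\<close>

lemma positive_linear_bounded:
  fixes f :: "'a::banach_lattice \<Rightarrow> 'b::banach_lattice"
  assumes lin: "linear f" and pos: "\<And>x. 0 \<le> x \<Longrightarrow> 0 \<le> f x"
  shows "bounded_linear f"
proof -
  have "\<exists>K. \<forall>x\<ge>0. norm (f x) \<le> K * norm x"
  proof (rule ccontr)
    assume "\<not> ?thesis"
    \<comment> \<open>The factor is chosen so that rescaling to norm \<open>(1/2) ^ k\<close> leaves
      an image of norm greater than \<open>k\<close>.\<close>
    hence "\<forall>k::nat. \<exists>x\<ge>0. norm (f x) > (real k * 2 ^ k) * norm x" by (meson not_le)
    then obtain x where x: "\<And>k. 0 \<le> x k" "\<And>k. norm (f (x k)) > (real k * 2 ^ k) * norm (x k)"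
      by metis
    have x0: "norm (x k) > 0" for k
      using x(2)[of k] linear_0[OF lin] by (cases "x k = 0") auto
    define y where "y k = (inverse (norm (x k)) * (1/2)^k) *\<^sub>R x k" for k
    have ynorm: "norm (y k) = (1/2)^k" for k using x0[of k] by (simp add: y_def)
    have ypos: "0 \<le> y k" for k
      unfolding y_def by (intro scaleR_nonneg_nonneg x) simp
    have fy: "real k < norm (f (y k))" for k
    proof -
      have "norm (f (y k)) = inverse (norm (x k)) * (1/2)^k * norm (f (x k))"
        by (simp add: y_def linear_scale[OF lin])
      also have "\<dots> > inverse (norm (x k)) * (1/2)^k * ((real k * 2 ^ k) * norm (x k))"
        using x(2)[of k] x0[of k] by (intro mult_strict_left_mono) auto
      also have "inverse (norm (x k)) * (1/2)^k * ((real k * 2 ^ k) * norm (x k)) = real k"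
        using x0[of k] by (simp add: field_simps)
      finally show ?thesis .
    qed
    have "summable (\<lambda>k. norm (y k))" unfolding ynorm by (intro summable_geometric) simp
    hence sy: "summable y" by (rule summable_norm_cancel)
    have "y k \<le> suminf y" for k
    proof (rule lim_mono_bl[OF tendsto_const summable_LIMSEQ[OF sy]])
      have "y k \<le> sum y {..<n}" if "n > k" for n
        using that ypos by (subst sum.remove[of _ k]) (auto intro: sum_nonneg)
      thus "eventually (\<lambda>n. y k \<le> sum y {..<n}) sequentially"
        by (auto simp: eventually_sequentially intro!: exI[of _ "Suc k"])
    qed
    hence "norm (f (y k)) \<le> norm (f (suminf y))" for k
      by (intro norm_mono_nonneg pos ypos positive_linear_mono[OF lin pos])
    hence "real k < norm (f (suminf y))" for k using fy[of k] by (meson less_le_trans)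
    thus False by (meson reals_Archimedean2 less_asym)
  qed
  then obtain K where K: "\<And>x. 0 \<le> x \<Longrightarrow> norm (f x) \<le> K * norm x" by blast
  have "norm (f x) \<le> norm x * K" for x
  proof -
    have "norm (f x) \<le> norm (f \<bar>x\<bar>)"
      by (rule norm_abs_mono) (use positive_linear_abs_le[OF lin pos, of x] abs_ge_self order_trans in blast)
    also have "\<dots> \<le> K * norm \<bar>x\<bar>" by (intro K) simp
    finally show ?thesis by (simp add: mult.commute)
  qed
  thus ?thesis using lin by (intro bounded_linear_intro) (auto simp: linear_add linear_scale)
qed

lemma inf_add_diff_eq:
  fixes g h :: "'a::banach_lattice"
  shows "inf (h + g) (h - g) = h - \<bar>g\<bar>"
proof -
  have "inf (h + g) (h - g) = h + inf g (- g)" by (simp add: add_inf_distrib_left)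
  also have "inf g (- g) = - \<bar>g\<bar>" unfolding inf_eq_neg_sup by (simp add: abs_lattice sup_commute)
  finally show ?thesis by simp
qed


section \<open>Weak limits of iterates\<close>

lemma linear_funpow: "linear f \<Longrightarrow> linear (f ^^ k)"
  for f :: "'a::real_vector \<Rightarrow> 'a"
  by (induction k) (simp_all only: funpow.simps linear_id linear_compose)

lemma bounded_linear_funpow: "bounded_linear f \<Longrightarrow> bounded_linear (f ^^ k)"
  for f :: "'a::real_normed_vector \<Rightarrow> 'a"
  by (induction k) (simp_all add: id_def o_def bounded_linear_ident bounded_linear_compose)

lemma linear_wlim_funpow:
  fixes A B :: "'a::banach_lattice \<Rightarrow> 'a"
  assumes A: "linear A" and F: "F \<noteq> bot" and lim: "\<And>x. wlim F (\<lambda>k. (A ^^ k) x) (B x)"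
  shows "linear B"
proof (rule linearI)
  note lin = linear_funpow[OF A]
  show "B (x + y) = B x + B y" for x y
    using wlim_unique[OF lim[of "x + y"] _ F] wlim_add[OF lim[of x] lim[of y]]
    by (simp add: linear_add[OF lin])
  show "B (c *\<^sub>R x) = c *\<^sub>R B x" for c x
    using wlim_unique[OF lim[of "c *\<^sub>R x"] _ F]
      wlim_bounded_linear[OF bounded_linear_scaleR_right lim[of x], of c]
    by (simp add: linear_scale[OF lin])
qed

text \<open>All powers of \<open>A\<close> commute with \<open>C\<close>, and bounded operators
  preserve weak limits.\<close>

lemma wlim_funpow_commute:
  fixes A B C :: "'a::banach_lattice \<Rightarrow> 'a"
  assumes C: "bounded_linear C" and F: "F \<noteq> bot" and lim: "\<And>x. wlim F (\<lambda>k. (A ^^ k) x) (B x)"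
    and comm: "\<And>x. A (C x) = C (A x)"
  shows "B (C x) = C (B x)"
proof -
  have "(A ^^ k) (C x) = C ((A ^^ k) x)" for k by (induction k) (simp_all add: comm)
  thus ?thesis using wlim_unique[OF lim[of "C x"] _ F] wlim_bounded_linear[OF C lim[of x]] by simp
qed

lemma funpow_fixed: "f x = x \<Longrightarrow> (f ^^ k) x = x"
  by (induction k) auto

lemma wlim_funpow_fixed:
  fixes A B :: "'a::banach_lattice \<Rightarrow> 'a"
  assumes F: "F \<noteq> bot" and lim: "\<And>x. wlim F (\<lambda>k. (A ^^ k) x) (B x)" and "A x = x"
  shows "B x = x"
  using wlim_unique[OF lim[of x] _ F] wlim_const[of F x] funpow_fixed[of A x, OF assms(3)] by simp

text \<open>In the lattice of fixed points of \<open>r\<close>, whose order is inherited from \<open>'a\<close>, the element \<open>h\<close> below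
  is the modulus of \<open>g\<close>.\<close>

lemma ex_fixed_modulus:
  fixes r :: "'a::banach_lattice \<Rightarrow> 'a" and q :: "nat \<Rightarrow> 'a \<Rightarrow> 'a" and K :: "'a \<Rightarrow> 'a set"
  assumes r: "bounded_linear r" and U: "U \<noteq> bot" "U \<le> sequentially"
    and q: "\<And>n. linear (q n)" "\<And>n x. 0 \<le> x \<Longrightarrow> 0 \<le> q n x" "\<And>x. (\<lambda>n. q n x) \<longlonglongrightarrow> x"
    and ev: "\<And>n x. 0 \<le> x \<Longrightarrow> eventually (\<lambda>k. 0 \<le> q n ((r ^^ k) x)) sequentially"
    and K_orbit: "\<And>k x. (r ^^ k) x \<in> K x" and K_trans: "\<And>x y. y \<in> K x \<Longrightarrow> K y \<subseteq> K x"
    and K_lim: "\<And>X x. (\<And>k. X k \<in> K x) \<Longrightarrow> \<exists>y\<in>K x. wlim U X y"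
    and g: "r g = g"
  shows "\<exists>h N. r h = h \<and> \<bar>g\<bar> \<le> h \<and> linear N \<and> (\<forall>x\<ge>0. 0 \<le> N x) \<and> N g = g \<and> N (h - \<bar>g\<bar>) = 0"
proof -
  \<comment> \<open>\<open>K x\<close> stands for the weak orbit closure of \<open>x\<close>; the
    zeroth iterate lies in it.\<close>
  have self: "x \<in> K x" for x using K_orbit[of 0 x] by simp
  have "\<forall>x. \<exists>y\<in>K x. wlim U (\<lambda>k. (r ^^ k) x) y" by (intro allI K_lim K_orbit)
  then obtain L where LK: "\<And>x. L x \<in> K x" and L: "\<And>x. wlim U (\<lambda>k. (r ^^ k) x) (L x)" by metis
  have L_lin: "linear L" by (rule linear_wlim_funpow[OF bounded_linear.linear[OF r] U(1) L])
  have q_bl: "bounded_linear (q n)" for n by (rule positive_linear_bounded[OF q(1,2)])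
  \<comment> \<open>Eventual positivity is known only behind \<open>q n\<close>. It passes to the
    weak limit along \<open>U\<close>, and then the limit in \<open>n\<close> removes
    \<open>q n\<close>. The power \<open>m\<close> only shifts the index \<open>k\<close>; it gives
    positivity of \<open>r\<close> after \<open>L\<close>, although \<open>r\<close> itself is not
    assumed positive.\<close>
  have shift_pos: "0 \<le> (r ^^ m) (L x)" if x: "0 \<le> x" for m x
  proof (rule lim_nonneg[OF q(3)], intro always_eventually allI)
    fix n
    have "wlim U (\<lambda>k. q n ((r ^^ m) ((r ^^ k) x))) (q n ((r ^^ m) (L x)))"
      by (intro wlim_bounded_linear[OF q_bl] wlim_bounded_linear[OF bounded_linear_funpow[OF r]] L)
    moreover have "eventually (\<lambda>k. 0 \<le> q n ((r ^^ (k + m)) x)) sequentially"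
      using ev[OF x, of n] by (subst eventually_sequentially_seg)
    hence "eventually (\<lambda>k. 0 \<le> q n ((r ^^ m) ((r ^^ k) x))) U"
      unfolding add.commute[of _ m] funpow_add o_apply by (rule filter_leD[OF U(2)])
    ultimately show "0 \<le> q n ((r ^^ m) (L x))" by (rule wlim_nonneg[OF _ U(1)])
  qed
  have L_pos: "0 \<le> L x" if "0 \<le> x" for x using shift_pos[OF that, of 0] by simp
  have L_bl: "bounded_linear L" by (rule positive_linear_bounded[OF L_lin L_pos])
  have L_mono: "L x \<le> L y" if "x \<le> y" for x y by (rule positive_linear_mono[OF L_lin L_pos that])
  have rL_lin: "linear (\<lambda>x. r (L x))"
    using linear_compose[OF L_lin bounded_linear.linear[OF r]] by (simp add: o_def)
  have Lr: "L (r x) = r (L x)" for x by (rule wlim_funpow_commute[OF r U(1) L]) simp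

  \<comment> \<open>Transitivity keeps the iterates of \<open>L\<close> in \<open>K x\<close>, so
    that they too have weak limits along \<open>U\<close>.\<close>
  have "(L ^^ k) x \<in> K x" for k x
  proof (induction k)
    case (Suc k)
    thus ?case using LK[of "(L ^^ k) x"] K_trans by auto
  qed (simp add: self)
  hence "\<forall>x. \<exists>y\<in>K x. wlim U (\<lambda>k. (L ^^ k) x) y" by (intro allI K_lim)
  then obtain N where N: "\<And>x. wlim U (\<lambda>k. (L ^^ k) x) (N x)" by metis
  have N_lin: "linear N" by (rule linear_wlim_funpow[OF L_lin U(1) N])
  have N_pos: "0 \<le> N x" if "0 \<le> x" for x
  proof (rule wlim_nonneg[OF N U(1)], intro always_eventually allI)
    show "0 \<le> (L ^^ k) x" for k by (induction k) (use that L_pos in auto)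
  qed
  have NL: "N (L x) = L (N x)" for x by (rule wlim_funpow_commute[OF L_bl U(1) N]) simp
  have Lg: "L g = g" by (rule wlim_funpow_fixed[OF U(1) L g])
  have Ng: "N g = g" by (rule wlim_funpow_fixed[OF U(1) N Lg])

  \<comment> \<open>From |g| \<le> L|g| the iterates of \<open>L\<close> at |g| increase; their weak
    limit is the least y \<ge> |g| with L y \<le> y.\<close>
  define h where "h = N \<bar>g\<bar>"
  have "\<bar>g\<bar> \<le> L \<bar>g\<bar>" using positive_linear_abs_le[OF L_lin L_pos, of g] Lg by simp
  hence "(L ^^ k) \<bar>g\<bar> \<le> (L ^^ Suc k) \<bar>g\<bar>" for k by (induction k) (auto intro: L_mono)
  hence incr: "(L ^^ k) \<bar>g\<bar> \<le> (L ^^ j) \<bar>g\<bar>" if "k \<le> j" for k j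
    using that by (rule lift_Suc_mono_le)
  have le_h: "(L ^^ k) \<bar>g\<bar> \<le> h" for k
    unfolding h_def
  proof (rule wlim_mono[OF wlim_const N U(1)])
    show "eventually (\<lambda>j. (L ^^ k) \<bar>g\<bar> \<le> (L ^^ j) \<bar>g\<bar>) U"
      by (rule filter_leD[OF U(2)]) (auto simp: eventually_sequentially intro!: exI[of _ k] incr)
  qed
  have g_le_h: "\<bar>g\<bar> \<le> h" using le_h[of 0] by simp
  have least: "h \<le> y" if "\<bar>g\<bar> \<le> y" "L y \<le> y" for y
    unfolding h_def
  proof (rule wlim_mono[OF N wlim_const U(1)], intro always_eventually allI)
    show "(L ^^ k) \<bar>g\<bar> \<le> y" for k
    proof (induction k)
      case (Suc k)
      thus ?case using L_mono[OF Suc] that(2) by simp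
    qed (use that in simp)
  qed
  \<comment> \<open>The bounded operator \<open>L\<close> passes through the weak limit defining
    \<open>h\<close>, which bounds \<open>L h\<close> above by \<open>h\<close>; conversely every
    iterate lies below \<open>L h\<close>.\<close>
  have Lh: "L h = h"
  proof (rule antisym)
    have "wlim U (\<lambda>k. L ((L ^^ k) \<bar>g\<bar>)) (L h)"
      unfolding h_def by (rule wlim_bounded_linear[OF L_bl N])
    thus "L h \<le> h"
      by (rule wlim_mono[OF _ wlim_const U(1)]) (use le_h[of "Suc _"] in simp)
  next
    have "(L ^^ k) \<bar>g\<bar> \<le> L h" for k
      using incr[of k "Suc k"] L_mono[OF le_h[of k]] by simp
    hence "N \<bar>g\<bar> \<le> L h" by (intro wlim_mono[OF N wlim_const U(1)]) simp
    thus "h \<le> L h" by (simp only: h_def)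
  qed
  \<comment> \<open>The composition of \<open>r\<close> with \<open>L\<close> is positive and agrees
    with \<open>r\<close> at the \<open>L\<close>-fixed vectors \<open>g\<close> and
    \<open>h\<close>, so -h \<le> g \<le> h is preserved by \<open>r\<close>.\<close>
  have "r (L g) \<le> r (L h)" "r (L (- h)) \<le> r (L g)"
    using g_le_h by (auto intro!: positive_linear_mono[OF rL_lin shift_pos[of _ 1, simplified]]
        dest: abs_le_D1 abs_le_D2 simp: minus_le_iff)
  moreover have "r (L (- h)) = - r (L h)" by (rule linear_neg[OF rL_lin])
  ultimately have g_le_rh: "\<bar>g\<bar> \<le> r h" using Lg Lh g by (intro abs_leI) (simp_all add: minus_le_iff)
  have L_rh: "L (r h) = r h" using Lr Lh by simp
  \<comment> \<open>Minimality of \<open>h\<close> applies because \<open>r h\<close> is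
    \<open>L\<close>-fixed and dominates |g|.\<close>
  have h_le: "h \<le> r h" by (rule least[OF g_le_rh]) (simp add: L_rh)
  \<comment> \<open>The vector \<open>r h - h\<close> is positive and \<open>L\<close>-fixed, so all
    its \<open>r\<close>-iterates are positive.\<close>
  have pow_incr: "(r ^^ k) h \<le> (r ^^ Suc k) h" for k
  proof -
    have "0 \<le> (r ^^ k) (L (r h - h))" using h_le by (intro shift_pos) simp
    also have "L (r h - h) = r h - h" using L_rh Lh by (simp add: linear_diff[OF L_lin])
    finally show ?thesis by (simp add: linear_diff[OF linear_funpow[OF bounded_linear.linear[OF r]]] funpow_swap1)
  qed
  \<comment> \<open>The increasing iterates have weak limit \<open>L h = h\<close>, hence
    \<open>r h\<close> lies below \<open>h\<close>.\<close>
  have "r h \<le> (r ^^ k) h" if "1 \<le> k" for k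
    using lift_Suc_mono_le[of "\<lambda>k. (r ^^ k) h", OF pow_incr that] by simp
  hence "eventually (\<lambda>k. r h \<le> (r ^^ k) h) U"
    by (intro filter_leD[OF U(2)]) (auto simp: eventually_sequentially)
  hence "r h \<le> L h" by (rule wlim_mono[OF wlim_const L U(1)])
  hence rh: "r h = h" using h_le Lh by simp
  have "N h = h" by (rule wlim_funpow_fixed[OF U(1) N Lh])
  hence "N (h - \<bar>g\<bar>) = 0" by (simp add: linear_diff[OF N_lin] h_def)
  thus ?thesis using rh g_le_h N_lin N_pos Ng by blast
qed


section \<open>Operators on the complexification\<close>

lemma bounded_bilinear_scaleC: "bounded_bilinear scaleC"
proof
  show "\<exists>K. \<forall>c z. norm (c *\<^sub>C z) \<le> norm c * norm z * K"
    by (rule exI[of _ 1]) (simp add: norm_scaleC)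
qed (auto intro: complexification_eqI simp: algebra_simps)

lemma clinear_add: "clinear A \<Longrightarrow> A (z + w) = A z + A w"
  and clinear_scaleC: "clinear A \<Longrightarrow> A (c *\<^sub>C z) = c *\<^sub>C A z"
  by (simp_all add: clinear_def)

lemma clinear_linear: "clinear A \<Longrightarrow> linear A"
  by (rule linearI) (simp_all add: clinear_add clinear_scaleC flip: scaleC_of_real)

lemma bounded_clinear_bounded_linear: "bounded_clinear A \<Longrightarrow> bounded_linear A"
  unfolding bounded_clinear_def bounded_linear_def bounded_linear_axioms_def
  by (auto simp: clinear_linear mult.commute)

definition real_restriction ::
    "('a::banach_lattice complexification \<Rightarrow> 'a complexification) \<Rightarrow> 'a \<Rightarrow> 'a" where
  "real_restriction A x = re_part (A (Cplx x 0))"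

lemma real_operator_of_real:
  "real_operator A \<Longrightarrow> A (Cplx x 0) = Cplx (real_restriction A x) 0"
  by (rule complexification_eqI)
     (auto simp: real_operator_def real_part_def real_restriction_def image_subset_iff)

lemma Cplx_add: "Cplx (x + y) 0 = Cplx x 0 + Cplx y (0::'a::banach_lattice)"
  and Cplx_scaleR: "Cplx (c *\<^sub>R x) 0 = c *\<^sub>R Cplx x (0::'a)"
  and Cplx_uminus: "Cplx (- x) 0 = - Cplx x (0::'a)"
  by (simp_all add: complexification_eqI)

lemma linear_real_restriction: "clinear A \<Longrightarrow> linear (real_restriction A)"
  by (rule linearI)
     (simp_all add: real_restriction_def Cplx_add Cplx_scaleR linear_add linear_scale clinear_linear)

lemma bounded_linear_real_restriction:
  assumes "bounded_clinear A"
  shows "bounded_linear (real_restriction A)"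
proof -
  have "bounded_linear (\<lambda>x. Cplx x (0::'a))"
    by (rule bounded_linear_intro[where K = 1]) (simp_all add: Cplx_add Cplx_scaleR)
  thus ?thesis
    unfolding real_restriction_def
    by (intro bounded_linear_compose[OF bounded_linear_re_part]
        bounded_linear_compose[OF bounded_clinear_bounded_linear[OF assms]])
qed

lemma real_operator_Cplx:
  assumes A: "real_operator A"
  shows "A z = Cplx (real_restriction A (re_part z)) (real_restriction A (im_part z))"
proof -
  have lin: "clinear A" using A by (simp add: real_operator_def)
  have "z = Cplx (re_part z) 0 + \<i> *\<^sub>C Cplx (im_part z) 0"
    by (rule complexification_eqI) simp_all
  hence "A z = A (Cplx (re_part z) 0) + \<i> *\<^sub>C A (Cplx (im_part z) 0)"
    by (simp only: clinear_add[OF lin, symmetric] clinear_scaleC[OF lin, symmetric])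
  thus ?thesis by (simp add: real_operator_of_real[OF A] complexification_eqI)
qed

section \<open>Positive operators and lattice homomorphisms\<close>

text \<open>A real vector is the difference of \<open>sup x 0\<close> and
  \<open>sup (- x) 0\<close>, both mapped into the cone; hence positive operators are real.\<close>

lemma positive_operator_of_real:
  assumes A: "positive_operator A"
  shows "A (Cplx x 0) = Cplx (real_restriction A x) 0" and "0 \<le> x \<Longrightarrow> 0 \<le> real_restriction A x"
proof -
  have lin: "clinear A" using A by (simp add: positive_operator_def)
  have pos: "im_part (A (Cplx y 0)) = 0" "0 \<le> real_restriction A y" if "0 \<le> y" for y
    using A that
    by (auto simp: positive_operator_def positive_cone_def real_restriction_def image_subset_iff)
  thus "0 \<le> x \<Longrightarrow> 0 \<le> real_restriction A x" by blast
  have "x = sup x 0 + inf x 0" using add_eq_inf_sup[of x 0] by (simp only: add_0_right)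
  also have "inf x 0 = - sup (- x) 0" by (simp only: inf_eq_neg_sup minus_zero)
  finally have "x = sup x 0 - sup (- x) 0" by (simp only: add_uminus_conv_diff)
  hence "Cplx x 0 = Cplx (sup x 0) 0 - Cplx (sup (- x) 0) 0" by (simp add: complexification_eqI)
  hence "A (Cplx x 0) = A (Cplx (sup x 0) 0) - A (Cplx (sup (- x) 0) 0)"
    by (simp add: linear_diff[OF clinear_linear[OF lin]])
  hence "im_part (A (Cplx x 0)) = 0" by (simp add: pos)
  thus "A (Cplx x 0) = Cplx (real_restriction A x) 0"
    by (intro complexification_eqI) (simp_all add: real_restriction_def)
qed

lemma positive_operator_real_operator:
  assumes A: "positive_operator A"
  shows "real_operator A"
proof -
  have "im_part (A z) = 0" if "im_part z = 0" for z
  proof -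
    have "z = Cplx (re_part z) 0" using that by (simp add: complexification_eqI)
    thus ?thesis using positive_operator_of_real(1)[OF A, of "re_part z"] by simp
  qed
  thus ?thesis using A by (auto simp: real_operator_def real_part_def positive_operator_def)
qed

text \<open>For x \<ge> 0 the image of x = sup x 0 is the supremum of its own image and 0.\<close>

lemma lattice_homomorphism_positive:
  assumes "lattice_homomorphism A"
  shows "positive_operator A"
proof -
  have real: "real_operator A" using assms by (simp add: lattice_homomorphism_def)
  hence lin: "clinear A" by (simp add: real_operator_def)
  have "A z \<in> positive_cone" if z: "z \<in> positive_cone" for z
  proof -
    have eq: "z = Cplx (re_part z) 0" "0 \<le> re_part z"
      using z by (auto simp: positive_cone_def intro: complexification_eqI)
    have "real_restriction A (sup (re_part z) 0)
        = sup (real_restriction A (re_part z)) (real_restriction A 0)"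
      using assms by (simp add: lattice_homomorphism_def real_restriction_def)
    moreover have "real_restriction A 0 = 0" by (rule linear_0[OF linear_real_restriction[OF lin]])
    ultimately have "0 \<le> real_restriction A (re_part z)"
      using eq(2) sup_ge2[of 0 "real_restriction A (re_part z)"] by (simp add: sup_absorb1)
    thus ?thesis
      by (subst eq(1), subst real_operator_of_real[OF real]) (simp add: positive_cone_def)
  qed
  thus ?thesis using lin by (auto simp: positive_operator_def)
qed

section \<open>Increasing operators with strong limit the identity\<close>

text \<open>An increasing convergent sequence lies below its limit, here \<open>x\<close>.\<close>

lemma increasing_operators_le:
  assumes P: "\<And>n. positive_operator (P n)" "increasing_operators P" "strongly_to_id P"
  shows "(\<lambda>n. real_restriction (P n) x) \<longlonglongrightarrow> x"
    and "0 \<le> x \<Longrightarrow> real_restriction (P n) x \<le> x"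
proof -
  show lim: "(\<lambda>n. real_restriction (P n) x) \<longlonglongrightarrow> x" for x
  proof -
    have "(\<lambda>n. re_part (P n (Cplx x 0))) \<longlonglongrightarrow> re_part (Cplx x 0)"
      using P(3) by (intro bounded_linear.tendsto[OF bounded_linear_re_part]) (simp add: strongly_to_id_def)
    thus ?thesis by (simp add: real_restriction_def)
  qed
  assume x: "0 \<le> x"
  have "real_restriction (P n) x \<le> real_restriction (P (Suc n)) x" for n
  proof -
    have "0 \<le> real_restriction (\<lambda>f. P (Suc n) f - P n f) x"
      using P(2) x by (intro positive_operator_of_real(2)) (simp_all add: increasing_operators_def)
    thus ?thesis by (simp add: real_restriction_def)
  qed
  hence "real_restriction (P n) x \<le> real_restriction (P m) x" if "n \<le> m" for m
    by (rule lift_Suc_mono_le[OF _ that])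
  thus "real_restriction (P n) x \<le> x"
    by (intro lim_mono_bl[OF tendsto_const lim[of x]])
       (auto simp: eventually_sequentially)
qed

text \<open>On the real part |P x| \<le> P|x| \<le> |x| gives a contraction; the factor 2 comes from
  adding real and imaginary parts.\<close>

lemma norm_increasing_operators_le:
  assumes P: "\<And>n. positive_operator (P n)" "increasing_operators P" "strongly_to_id P"
  shows "norm (P n z) \<le> 2 * norm z"
proof -
  have lin: "linear (real_restriction (P n))"
    using P(1) by (intro linear_real_restriction) (simp add: positive_operator_def)
  have le: "norm (real_restriction (P n) x) \<le> norm x" for x
  proof -
    have "\<bar>real_restriction (P n) x\<bar> \<le> real_restriction (P n) \<bar>x\<bar>"
      by (rule positive_linear_abs_le[OF lin positive_operator_of_real(2)[OF P(1)]])
    also have "\<dots> \<le> \<bar>x\<bar>" by (rule increasing_operators_le(2)[OF P]) simp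
    finally show ?thesis by (rule norm_abs_mono)
  qed
  have "norm (P n z) \<le> norm (real_restriction (P n) (re_part z)) + norm (real_restriction (P n) (im_part z))"
    using norm_complexification_le[of "P n z"]
      real_operator_Cplx[OF positive_operator_real_operator[OF P(1)], of n z] by simp
  also have "\<dots> \<le> norm (re_part z) + norm (im_part z)" by (intro add_mono le)
  also have "\<dots> \<le> 2 * norm z" using norm_re_le[of z] norm_im_le[of z] by simp
  finally show ?thesis .
qed


section \<open>Relatively compact orbits\<close>

text \<open>Pointwise convergence on a finite net extends to the whole set by the uniform bound 2.
  Net radius \<open>e / 6\<close> and tolerance \<open>e / 2\<close> add up to e/2 + e/6 + 2(e/6) =
  e.\<close>

lemma uniform_on_relatively_compact:
  assumes P: "\<And>n. positive_operator (P n)" "increasing_operators P" "strongly_to_id P"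
    and S: "relatively_compact S" and e: "(e::real) > 0"
  shows "\<exists>n. \<forall>z\<in>S. norm (P n z - z) < e"
proof -
  have "closure S \<subseteq> (\<Union>c\<in>closure S. ball c (e / 6))" using e by auto
  then obtain C where C: "C \<subseteq> closure S" "finite C" "closure S \<subseteq> (\<Union>c\<in>C. ball c (e / 6))"
    using S unfolding relatively_compact_def
    by (elim compactE_image) auto
  have "eventually (\<lambda>n. \<forall>c\<in>C. norm (P n c - c) < e / 2) sequentially"
  proof (intro eventually_ball_finite C(2) ballI)
    fix c assume "c \<in> C"
    have "(\<lambda>n. P n c) \<longlonglongrightarrow> c" using P(3) by (simp add: strongly_to_id_def)
    hence "eventually (\<lambda>n. dist (P n c) c < e / 2) sequentially" using e by (intro tendstoD) auto
    thus "eventually (\<lambda>n. norm (P n c - c) < e / 2) sequentially" by (simp only: dist_norm)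
  qed
  then obtain n where n: "\<And>c. c \<in> C \<Longrightarrow> norm (P n c - c) < e / 2"
    by (auto simp: eventually_sequentially)
  have "norm (P n z - z) < e" if z: "z \<in> S" for z
  proof -
    obtain c where c: "c \<in> C" "norm (c - z) < e / 6"
      using C(3) z closure_subset[of S] by (auto simp: dist_norm subset_iff)
    have lin: "linear (P n)" using P(1) by (simp add: positive_operator_def clinear_linear)
    have eq: "P n z - z = (P n c - c) + (c - z) - P n (c - z)" by (simp add: linear_diff[OF lin])
    have "norm (P n z - z) \<le> norm (P n c - c) + norm (c - z) + norm (P n (c - z))"
      using norm_triangle_ineq4[of "(P n c - c) + (c - z)" "P n (c - z)"] norm_triangle_ineq[of "P n c - c" "c - z"]
      unfolding eq by linarith
    also have "\<dots> \<le> norm (P n c - c) + norm (c - z) + 2 * norm (c - z)"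
      by (intro add_left_mono norm_increasing_operators_le[OF P])
    also have "\<dots> < e" using n[OF c(1)] c(2) by simp
    finally show ?thesis .
  qed
  thus ?thesis by blast
qed

lemma LEP_infdist_tendsto_0:
  assumes P: "\<And>n. positive_operator (P n)" "increasing_operators P" "strongly_to_id P"
    and LEP: "LEP P T" and T: "\<And>t. 0 \<le> t \<Longrightarrow> clinear (T t)"
    and orbit: "relatively_compact (orbit T f)" and f: "f \<in> positive_cone"
  shows "((\<lambda>t. infdist (T t f) positive_cone) \<longlongrightarrow> 0) at_top"
proof (rule tendstoI)
  fix e :: real assume e: "e > 0"
  \<comment> \<open>The index is fixed for the whole orbit before a time is chosen, because the LEP
    time depends on it.\<close>
  obtain n where n: "\<And>z. z \<in> orbit T f \<Longrightarrow> norm (P n z - z) < e"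
    using uniform_on_relatively_compact[OF P orbit e] by blast
  have "eventually (\<lambda>t. P n (T t f) \<in> positive_cone \<and> 0 \<le> t) at_top"
  proof (cases "f = 0")
    case True
    have "P n (T t f) \<in> positive_cone" if "0 \<le> t" for t
    proof -
      have "linear (P n)" using P(1) by (simp add: positive_operator_def clinear_linear)
      thus ?thesis
        using True T[OF that] by (simp add: linear_0 clinear_linear positive_cone_def)
    qed
    thus ?thesis unfolding eventually_at_top_linorder by blast
  next
    case False
    then obtain \<tau> where "\<tau> > 0" "\<And>t. t \<ge> \<tau> \<Longrightarrow> P n (T t f) \<in> positive_cone"
      using LEP f unfolding LEP_def by blast
    thus ?thesis unfolding eventually_at_top_linorder by (intro exI[of _ \<tau>]) auto
  qed
  thus "eventually (\<lambda>t. dist (infdist (T t f) positive_cone) 0 < e) at_top"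
  proof eventually_elim
    case (elim t)
    hence "infdist (T t f) positive_cone \<le> dist (T t f) (P n (T t f))" by (intro infdist_le) auto
    also have "\<dots> = norm (P n (T t f) - T t f)" by (simp only: dist_norm norm_minus_commute)
    also have "\<dots> < e" using elim by (intro n) (auto simp: orbit_def)
    finally show ?case by (simp add: infdist_nonneg)
  qed
qed


section \<open>Weakly compact orbits\<close>

lemma weak_continuous_functional:
  assumes "\<phi> \<in> dual_space"
  shows "continuous_map weak_topology euclidean \<phi>"
  unfolding continuous_map_def
proof (intro conjI allI impI)
  fix V :: "complex set" assume "openin euclidean V"
  hence "openin weak_topology (\<phi> -` V)"
    unfolding weak_topology_def using assms by (intro topology_generated_by_Basis) auto
  thus "openin weak_topology {z \<in> topspace weak_topology. \<phi> z \<in> V}" by (simp add: vimage_def)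
qed simp

text \<open>Composing a dual functional with \<open>A\<close> gives a dual functional, so preimages
  of subbasic sets are subbasic.\<close>

lemma bounded_clinear_weak_continuous:
  assumes A: "bounded_clinear A"
  shows "continuous_map weak_topology weak_topology A"
  unfolding weak_topology_def
proof (rule continuous_on_generated_topo, goal_cases)
  case (1 W)
  then obtain \<phi> V where W: "W = \<phi> -` V" "\<phi> \<in> dual_space" "open V" by blast
  obtain K where K: "\<And>z. norm (A z) \<le> K * norm z" using A by (auto simp: bounded_clinear_def)
  obtain M where M: "\<And>z. cmod (\<phi> z) \<le> M * norm z" using W(2) by (auto simp: dual_space_def)
  have "cmod (\<phi> (A z)) \<le> (\<bar>M\<bar> * \<bar>K\<bar>) * norm z" for z
  proof -
    have "cmod (\<phi> (A z)) \<le> \<bar>M\<bar> * norm (A z)"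
      using M[of "A z"] by (meson abs_ge_self mult_right_mono norm_ge_zero order_trans)
    also have "norm (A z) \<le> \<bar>K\<bar> * norm z"
      using K[of z] by (meson abs_ge_self mult_right_mono norm_ge_zero order_trans)
    finally show ?thesis by (simp add: mult_left_mono mult.assoc)
  qed
  hence "(\<lambda>z. \<phi> (A z)) \<in> dual_space"
    using W(2) A unfolding dual_space_def bounded_clinear_def clinear_def by (auto intro!: exI)
  moreover have "A -` W = (\<lambda>z. \<phi> (A z)) -` V" using W(1) by auto
  ultimately have "openin weak_topology (A -` W)"
    unfolding weak_topology_def using W(3) by (intro topology_generated_by_Basis) blast
  thus ?case using topspace_weak_topology[where 'a = 'a] by (simp add: weak_topology_def)
next
  case 2
  show ?case
    using topspace_weak_topology[where 'a = 'a] by (simp only: weak_topology_def topology_generated_by_topspace subset_UNIV)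
qed

text \<open>Through this extension the weak topology controls real and imaginary parts
  separately.\<close>

lemma complexified_functional:
  fixes \<phi> :: "'a::banach_lattice \<Rightarrow> real"
  assumes \<phi>: "bounded_linear \<phi>"
  shows "(\<lambda>z. Complex (\<phi> (re_part z)) (\<phi> (im_part z))) \<in> dual_space"
proof -
  have lin: "linear \<phi>" using \<phi> by (rule bounded_linear.linear)
  obtain K where K: "K \<ge> 0" "\<And>x. norm (\<phi> x) \<le> norm x * K"
    using bounded_linear.nonneg_bounded[OF \<phi>] by blast
  have "cmod (Complex (\<phi> (re_part z)) (\<phi> (im_part z))) \<le> 2 * K * norm z" for z
  proof -
    have "cmod (Complex (\<phi> (re_part z)) (\<phi> (im_part z))) \<le> \<bar>\<phi> (re_part z)\<bar> + \<bar>\<phi> (im_part z)\<bar>"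
      using cmod_le[of "Complex (\<phi> (re_part z)) (\<phi> (im_part z))"] by simp
    also have "\<dots> \<le> norm (re_part z) * K + norm (im_part z) * K"
      using K(2)[of "re_part z"] K(2)[of "im_part z"] by simp
    also have "\<dots> \<le> norm z * K + norm z * K"
      by (intro add_mono mult_right_mono norm_re_le norm_im_le K(1))
    finally show ?thesis by simp
  qed
  thus ?thesis
    unfolding dual_space_def
    by (auto simp: complex_eq_iff linear_add[OF lin] linear_diff[OF lin] linear_scale[OF lin])
qed

lemma limitin_weak_topology_wlim:
  assumes lim: "limitin weak_topology X z F"
  shows "wlim F (\<lambda>i. re_part (X i)) (re_part z)" and "wlim F (\<lambda>i. im_part (X i)) (im_part z)"
proof -
  have *: "((\<lambda>i. Complex (\<phi> (re_part (X i))) (\<phi> (im_part (X i))))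
      \<longlongrightarrow> Complex (\<phi> (re_part z)) (\<phi> (im_part z))) F" if "bounded_linear \<phi>" for \<phi>
    using continuous_map_limit[OF weak_continuous_functional[OF complexified_functional[OF that]] lim]
    by (simp add: o_def)
  show "wlim F (\<lambda>i. re_part (X i)) (re_part z)"
    unfolding wlim_def using tendsto_Re[OF *] by simp
  show "wlim F (\<lambda>i. im_part (X i)) (im_part z)"
    unfolding wlim_def using tendsto_Im[OF *] by simp
qed

section \<open>Orbit closures and rescaling of semigroups\<close>

lemma C0_semigroupD:
  assumes "C0_semigroup T"
  shows "0 \<le> t \<Longrightarrow> bounded_clinear (T t)" "0 \<le> t \<Longrightarrow> clinear (T t)" "T 0 f = f"
    "0 \<le> s \<Longrightarrow> 0 \<le> t \<Longrightarrow> T (s + t) f = T s (T t f)" "continuous_on {0..} (\<lambda>t. T t f)"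
  using assms by (auto simp: C0_semigroup_def bounded_clinear_def)

text \<open>Weak continuity of each \<open>T t\<close> makes the weak closure of an orbit invariant,
  so it contains the closed orbit of each of its points.\<close>

lemma weak_orbit_closure_trans:
  assumes T: "C0_semigroup T" and z: "z \<in> weak_topology closure_of (orbit T f)"
  shows "weak_topology closure_of (orbit T z) \<subseteq> weak_topology closure_of (orbit T f)"
proof (rule closure_of_minimal)
  show "orbit T z \<subseteq> weak_topology closure_of (orbit T f)"
  proof
    fix w assume "w \<in> orbit T z"
    then obtain t where t: "0 \<le> t" "w = T t z" by (auto simp: orbit_def)
    have "T t ` (weak_topology closure_of (orbit T f)) \<subseteq> weak_topology closure_of (T t ` orbit T f)"
      by (rule continuous_map_image_closure_subset[OF bounded_clinear_weak_continuous[OF C0_semigroupD(1)[OF T t(1)]]])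
    also have "\<dots> \<subseteq> weak_topology closure_of (orbit T f)"
    proof (rule closure_of_mono)
      show "T t ` orbit T f \<subseteq> orbit T f"
      proof clarify
        fix w assume "w \<in> orbit T f"
        then obtain u where u: "0 \<le> u" "w = T u f" by (auto simp: orbit_def)
        have "T t w = T (t + u) f" using C0_semigroupD(4)[OF T t(1) u(1)] u by simp
        thus "T t w \<in> orbit T f" using t u unfolding orbit_def by (intro CollectI exI[of _ "t + u"]) simp
      qed
    qed
    finally show "w \<in> weak_topology closure_of (orbit T f)" using z t(2) by blast
  qed
qed simp

lemma rescaled_C0_semigroup:
  assumes T: "C0_semigroup T"
  shows "C0_semigroup (rescaled_semigroup s T)"
  unfolding C0_semigroup_def
proof (intro conjI allI impI)
  fix t :: real assume t: "0 \<le> t"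
  note lin = C0_semigroupD(2)[OF T t]
  obtain K where K: "\<And>z. norm (T t z) \<le> K * norm z"
    using C0_semigroupD(1)[OF T t] by (auto simp: bounded_clinear_def)
  have "norm (rescaled_semigroup s T t z) \<le> (exp (- (t * s)) * K) * norm z" for z
    using K[of z] by (simp add: rescaled_semigroup_def mult.assoc)
  moreover have "clinear (rescaled_semigroup s T t)"
    unfolding clinear_def rescaled_semigroup_def
    by (simp add: clinear_add[OF lin] clinear_scaleC[OF lin] scaleC_add_right
        scaleC_scaleC mult.commute flip: scaleC_of_real)
  ultimately show "bounded_clinear (rescaled_semigroup s T t)" unfolding bounded_clinear_def by blast
  fix u :: real and f assume u: "0 \<le> u"
  have "rescaled_semigroup s T (t + u) f = exp (- (t * s)) *\<^sub>R exp (- (u * s)) *\<^sub>R T t (T u f)"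
    by (simp add: rescaled_semigroup_def C0_semigroupD(4)[OF T t u] algebra_simps flip: exp_add)
  also have "\<dots> = rescaled_semigroup s T t (rescaled_semigroup s T u f)"
    by (simp add: rescaled_semigroup_def linear_scale[OF clinear_linear[OF lin]])
  finally show "rescaled_semigroup s T (t + u) f = rescaled_semigroup s T t (rescaled_semigroup s T u f)" .
next
  show "rescaled_semigroup s T 0 f = f" for f
    by (simp add: rescaled_semigroup_def C0_semigroupD(3)[OF T])
  show "continuous_on {0..} (\<lambda>t. rescaled_semigroup s T t f)" for f
    unfolding rescaled_semigroup_def by (intro continuous_intros C0_semigroupD(5)[OF T])
qed

lemma rescaled_real_semigroup:
  assumes "real_semigroup T" and T: "C0_semigroup T"
  shows "real_semigroup (rescaled_semigroup s T)"
  using assms C0_semigroupD(2)[OF rescaled_C0_semigroup[OF T]]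
  unfolding real_semigroup_def real_operator_def rescaled_semigroup_def
  by (auto simp: real_part_def image_subset_iff)


section \<open>Eigenvectors of the generator\<close>

text \<open>If the bound e u on norm(v u - v 0) failed at \<open>t\<close>, the last
  \<open>c\<close> in [0, t] where it holds would be less than \<open>t\<close>, and the right
  derivative at \<open>c\<close> would extend the bound beyond \<open>c\<close>.\<close>

lemma constant_if_right_derivative_zero:
  fixes v :: "real \<Rightarrow> 'b::real_normed_vector"
  assumes cont: "continuous_on {0..} v"
    and deriv: "\<And>t. 0 \<le> t \<Longrightarrow> ((\<lambda>h. (v (t + h) - v t) /\<^sub>R h) \<longlongrightarrow> 0) (at_right 0)"
    and t: "0 \<le> t"
  shows "v t = v 0"
proof -
  have bound: "norm (v t - v 0) \<le> e * t" if e: "e > 0" for e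
  proof (rule ccontr)
    assume bad: "\<not> ?thesis"
    define G where "G = {u \<in> {0..t}. norm (v u - v 0) \<le> e * u}"
    have "continuous_on {0..t} v" by (rule continuous_on_subset[OF cont]) auto
    hence "closed G" unfolding G_def
      by (intro continuous_on_closed_Collect_le continuous_intros) auto
    moreover have "bounded G" by (rule bounded_subset[of "{0..t}"]) (auto simp: G_def)
    ultimately have "compact G" by (simp add: compact_eq_bounded_closed)
    moreover have "0 \<in> G" using t by (simp add: G_def)
    ultimately obtain c where c: "c \<in> G" "\<And>u. u \<in> G \<Longrightarrow> u \<le> c"
      using compact_attains_sup[of G] by blast
    have c': "0 \<le> c" "c \<le> t" "norm (v c - v 0) \<le> e * c" using c(1) by (auto simp: G_def)
    have "c \<noteq> t" using c'(3) bad by auto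
    hence "c < t" using c' by simp
    have "eventually (\<lambda>h. norm ((v (c + h) - v c) /\<^sub>R h) < e) (at_right 0)"
      using tendstoD[OF deriv[OF c'(1)] e] by (simp add: dist_norm)
    moreover have "eventually (\<lambda>h. h < t - c) (at_right 0)"
      using \<open>c < t\<close> by (intro eventually_at_right_less[THEN eventually_mono] eventually_at_rightI[of 0 "t - c"]) auto
    moreover have "eventually (\<lambda>h::real. 0 < h) (at_right 0)" by (rule eventually_at_right_less)
    ultimately have "eventually (\<lambda>h. c + h \<in> G \<and> 0 < h) (at_right 0)"
    proof eventually_elim
      case (elim h)
      have "inverse h * norm (v (c + h) - v c) < e" using elim(1,3) by (simp only: norm_scaleR) simp
      hence "norm (v (c + h) - v c) \<le> e * h" using elim(3) by (simp add: field_simps)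
      moreover have "norm (v (c + h) - v 0) \<le> norm (v (c + h) - v c) + norm (v c - v 0)"
        using norm_triangle_ineq[of "v (c + h) - v c" "v c - v 0"] by simp
      ultimately show ?case using c' elim by (auto simp: G_def algebra_simps)
    qed
    then obtain h where "c + h \<in> G" "0 < h"
      using eventually_happens'[OF trivial_limit_at_right_real] by blast
    thus False using c(2) by fastforce
  qed
  have "norm (v t - v 0) \<le> 0"
  proof (rule field_le_epsilon)
    fix e :: real assume e: "e > 0"
    have "norm (v t - v 0) \<le> e / (t + 1) * t" using e t by (intro bound) simp
    also have "\<dots> \<le> e" using e t by (simp add: field_simps)
    finally show "norm (v t - v 0) \<le> 0 + e" by simp
  qed
  thus ?thesis by simp
qed

text \<open>The function v(t) = exp(-\<mu> t) T(t) f has right derivative zero at 0 by the product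
  rule, hence everywhere by the semigroup law, so it is constant.\<close>

lemma semigroup_eigenvector:
  assumes T: "C0_semigroup T" and f: "f \<in> generator_domain T" "generator T f = \<mu> *\<^sub>C f"
    and t: "0 \<le> t"
  shows "T t f = exp (\<mu> * of_real t) *\<^sub>C f"
proof -
  interpret scaleC: bounded_bilinear scaleC by (rule bounded_bilinear_scaleC)
  obtain g where g: "((\<lambda>t. (T t f - f) /\<^sub>R t) \<longlongrightarrow> g) (at_right 0)"
    using f(1) by (auto simp: generator_domain_def)
  hence "generator T f = g" unfolding generator_def by (intro tendsto_Lim) auto
  hence Af: "((\<lambda>t. (T t f - f) /\<^sub>R t) \<longlongrightarrow> \<mu> *\<^sub>C f) (at_right 0)" using g f(2) by simp
  define v where "v t = exp (- \<mu> * of_real t) *\<^sub>C T t f" for t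
  have "((\<lambda>h::complex. exp (- \<mu> * h)) has_field_derivative - \<mu>) (at 0)"
    by (auto intro!: derivative_eq_intros)
  hence "(\<lambda>h. (exp (- \<mu> * h) - 1) / h) \<midarrow>0\<rightarrow> - \<mu>" by (simp add: DERIV_def)
  moreover have "filterlim complex_of_real (at 0) (at_right 0)"
    by (auto simp: filterlim_at eventually_at_filter intro!: tendsto_eq_intros)
  ultimately have "((\<lambda>h. (exp (- \<mu> * of_real h) - 1) / of_real h) \<longlongrightarrow> - \<mu>) (at_right 0)"
    by (rule filterlim_compose)
  hence "((\<lambda>h. exp (- \<mu> * of_real h) *\<^sub>C ((T h f - f) /\<^sub>R h)
      + ((exp (- \<mu> * of_real h) - 1) / of_real h) *\<^sub>C f) \<longlongrightarrow>
      exp (- \<mu> * of_real 0) *\<^sub>C (\<mu> *\<^sub>C f) + (- \<mu>) *\<^sub>C f) (at_right 0)"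
    by (intro tendsto_add scaleC.tendsto Af tendsto_intros)
  moreover have "exp (- \<mu> * of_real h) *\<^sub>C ((T h f - f) /\<^sub>R h)
      + ((exp (- \<mu> * of_real h) - 1) / of_real h) *\<^sub>C f = (v h - f) /\<^sub>R h" for h
    unfolding v_def
    by (simp add: scaleC_of_real[symmetric] scaleC_scaleC scaleC.diff_right scaleC.diff_left
        diff_divide_distrib divide_inverse mult.commute algebra_simps)
  ultimately have v0: "((\<lambda>h. (v h - f) /\<^sub>R h) \<longlongrightarrow> 0) (at_right 0)"
    by (simp add: scaleC.minus_left)
  have "v t = v 0"
  proof (rule constant_if_right_derivative_zero[OF _ _ t])
    show "continuous_on {0..} v"
      unfolding v_def by (intro scaleC.continuous_on continuous_intros C0_semigroupD(5)[OF T])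
  next
    fix t :: real assume t: "0 \<le> t"
    note bl = bounded_clinear_bounded_linear[OF C0_semigroupD(1)[OF T t]]
    have lin: "linear (T t)" by (rule bounded_linear.linear[OF bl])
    \<comment> \<open>The difference quotient at \<open>t\<close> is the image of the one at 0 under
      a bounded operator.\<close>
    have "(v (t + h) - v t) /\<^sub>R h = exp (- \<mu> * of_real t) *\<^sub>C T t ((v h - f) /\<^sub>R h)" if "0 < h" for h
    proof -
      have "v (t + h) = exp (- \<mu> * of_real t) *\<^sub>C T t (v h)"
        using C0_semigroupD(4)[OF T t, of h f] that unfolding v_def
        by (simp add: clinear_scaleC[OF C0_semigroupD(2)[OF T t]]
            scaleC_scaleC algebra_simps flip: exp_add)
      thus ?thesis
        by (simp add: v_def linear_scale[OF lin] linear_diff[OF lin] scaleC.scaleR_right scaleC.diff_right)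
    qed
    hence eq: "eventually (\<lambda>h. exp (- \<mu> * of_real t) *\<^sub>C T t ((v h - f) /\<^sub>R h) = (v (t + h) - v t) /\<^sub>R h) (at_right 0)"
      by (auto simp: eventually_at_filter)
    have "((\<lambda>h. exp (- \<mu> * of_real t) *\<^sub>C T t ((v h - f) /\<^sub>R h)) \<longlongrightarrow> exp (- \<mu> * of_real t) *\<^sub>C T t 0) (at_right 0)"
      by (intro scaleC.tendsto tendsto_const bounded_linear.tendsto[OF bl] v0)
    thus "((\<lambda>h. (v (t + h) - v t) /\<^sub>R h) \<longlongrightarrow> 0) (at_right 0)"
      using tendsto_cong[OF eq] by (simp add: linear_0[OF lin] scaleC.zero_right)
  qed
  hence "exp (- \<mu> * of_real t) *\<^sub>C T t f = f" by (simp add: v_def C0_semigroupD(3)[OF T])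
  hence "exp (\<mu> * of_real t) *\<^sub>C f = (exp (\<mu> * of_real t) * exp (- \<mu> * of_real t)) *\<^sub>C T t f"
    by (simp only: scaleC_scaleC[symmetric])
  thus ?thesis by (simp flip: exp_add)
qed


section \<open>Quasi-interior points\<close>

lemma csubspace_closed_sublattice_generated_by: "csubspace (closed_sublattice_generated_by S)"
proof -
  have "csubspace F" if "sublattice F" for F :: "'a complexification set"
    using that unfolding sublattice_def csubspace_def vector_sublattice_def
    by (auto simp: subspace_0 subspace_add subspace_diff subspace_scale)
  thus ?thesis
    unfolding closed_sublattice_generated_by_def hull_def csubspace_def by auto
qed

lemma range_subset_closed_sublattice_generated_by: "A z \<in> closed_sublattice_generated_by (range A)"
  unfolding closed_sublattice_generated_by_def by (rule hull_inc) simp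

text \<open>A complex subspace containing \<open>c *\<^sub>R u\<close> contains \<open>u\<close>, so
  the ideal of \<open>u\<close> lies in that of \<open>c *\<^sub>R u\<close>.\<close>

lemma quasi_interior_point_scaleR:
  assumes F: "csubspace F" and c: "0 < c" and u: "quasi_interior_point F u"
  shows "quasi_interior_point F (c *\<^sub>R u)"
proof -
  have "c *\<^sub>R u \<in> F \<inter> positive_cone"
    using u c F unfolding quasi_interior_point_def csubspace_def positive_cone_def
    by (auto simp: scaleR_nonneg_nonneg simp flip: scaleC_of_real)
  moreover have "u \<in> I" if "csubspace I" "c *\<^sub>R u \<in> I" for I
  proof -
    have "complex_of_real (inverse c) *\<^sub>C c *\<^sub>R u \<in> I" using that by (auto simp: csubspace_def)
    thus ?thesis using c by (simp add: scaleC_of_real del: of_real_inverse)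
  qed
  hence "ideal_of F hull {u} \<subseteq> ideal_of F hull {c *\<^sub>R u}"
    by (auto simp: hull_def ideal_of_def)
  hence "F \<subseteq> closure (ideal_of F hull {c *\<^sub>R u})"
    using u closure_mono unfolding quasi_interior_point_def by blast
  ultimately show ?thesis by (simp add: quasi_interior_point_def)
qed

text \<open>The null ideal of a monotone subadditive map is closed, so it contains every $z \in F$ once it
  contains a quasi-interior point of \<open>F\<close>.\<close>

lemma null_if_null_quasi_interior:
  fixes M :: "'a::banach_lattice \<Rightarrow> 'a"
  assumes F: "csubspace F" and u: "quasi_interior_point F u" "M (modulus u) = 0"
    and M0: "M 0 = 0" and mono: "\<And>x y. 0 \<le> x \<Longrightarrow> x \<le> y \<Longrightarrow> M x \<le> M y"
    and add: "\<And>x y. 0 \<le> x \<Longrightarrow> 0 \<le> y \<Longrightarrow> M (x + y) \<le> M x + M y"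
    and scale: "\<And>c x. 0 \<le> c \<Longrightarrow> 0 \<le> x \<Longrightarrow> M x = 0 \<Longrightarrow> M (c *\<^sub>R x) = 0"
    and bound: "\<And>x. 0 \<le> x \<Longrightarrow> norm (M x) \<le> K * norm x" and z: "z \<in> F"
  shows "M (modulus z) = 0"
proof -
  have pos: "0 \<le> M x" if "0 \<le> x" for x using mono[of 0 x] M0 that by simp
  define I where "I = {w \<in> F. M (modulus w) = 0}"
  have "ideal_of F I"
    unfolding ideal_of_def csubspace_def
  proof (intro conjI ballI allI impI)
    show "I \<subseteq> F" by (auto simp: I_def)
    show "0 \<in> I" using F M0 by (auto simp: I_def csubspace_def zero_complexification_def)
    show "w + w' \<in> I" if w: "w \<in> I" "w' \<in> I" for w w'
    proof -
      have "M (modulus (w + w')) \<le> M (modulus w + modulus w')" by (intro mono modulus_triangle) simp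
      also have "\<dots> \<le> M (modulus w) + M (modulus w')" by (intro add) simp_all
      finally have "M (modulus (w + w')) = 0"
        using w pos[of "modulus (w + w')"] by (intro antisym) (simp_all add: I_def)
      thus ?thesis using F w by (auto simp: I_def csubspace_def)
    qed
    show "c *\<^sub>C w \<in> I" if w: "w \<in> I" for c w
      using F w by (auto simp: I_def csubspace_def modulus_scaleC intro: scale)
    show "w \<in> I" if "w \<in> F" "w' \<in> I" "modulus w \<le> modulus w'" for w w'
      using that mono[of "modulus w" "modulus w'"] pos[of "modulus w"]
      by (auto simp: I_def intro: antisym)
  qed
  moreover have "u \<in> I" using u by (auto simp: I_def quasi_interior_point_def)
  ultimately have "ideal_of F hull {u} \<subseteq> I" by (intro hull_minimal) auto
  hence zI: "z \<in> closure I" using u(1) z closure_mono unfolding quasi_interior_point_def by blast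
  have "norm (M (modulus z)) \<le> 0"
  proof (rule field_le_epsilon)
    fix e :: real assume e: "e > 0"
    \<comment> \<open>Adding 1 keeps the divisor positive when \<open>K\<close> is zero.\<close>
    have "e / (\<bar>K\<bar> + 1) > 0" using e by (simp add: field_simps)
    then obtain w where w: "w \<in> I" "dist w z < e / (\<bar>K\<bar> + 1)"
      using zI unfolding closure_approachable by blast
    have "modulus z \<le> modulus w + modulus (z - w)" using modulus_triangle[of w "z - w"] by simp
    hence "M (modulus z) \<le> M (modulus w + modulus (z - w))" by (intro mono) simp_all
    also have "\<dots> \<le> M (modulus w) + M (modulus (z - w))" by (intro add) simp_all
    also have "\<dots> = M (modulus (z - w))" using w(1) by (simp add: I_def)
    finally have "norm (M (modulus z)) \<le> norm (M (modulus (z - w)))"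
      by (intro norm_mono_nonneg pos) simp
    also have "\<dots> \<le> K * norm (z - w)"
      using bound[of "modulus (z - w)"] by (simp add: norm_complexification_def)
    also have "\<dots> \<le> (\<bar>K\<bar> + 1) * norm (z - w)" by (intro mult_right_mono) auto
    also have "\<dots> \<le> e" using w(2) by (simp add: dist_norm norm_minus_commute field_simps)
    finally show "norm (M (modulus z)) \<le> 0 + e" by simp
  qed
  thus ?thesis by simp
qed

section \<open>Truncation by a positive element\<close>

text \<open>With w = inf (x + y) b one has w - inf x b = sup (w - x) (w - b), and both entries lie
  below \<open>y\<close> and \<open>b\<close>.\<close>

lemma inf_add_le:
  fixes x y b :: "'a::banach_lattice"
  assumes "0 \<le> x" "0 \<le> y" "0 \<le> b"
  shows "inf (x + y) b \<le> inf x b + inf y b"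
proof -
  define w where "w = inf (x + y) b"
  have w: "w \<le> x + y" "w \<le> b" by (simp_all add: w_def)
  have "w - x \<le> y" using w(1) by (simp add: algebra_simps)
  moreover have "w - x \<le> b" using w(2) assms(1) by (metis diff_mono diff_zero)
  moreover have "w - b \<le> 0" using w(2) by simp
  hence "w - b \<le> y" "w - b \<le> b" using assms order_trans by blast+
  ultimately have "sup (w - x) (w - b) \<le> inf y b" by simp
  hence "w - inf x b \<le> inf y b" by (simp only: diff_inf_eq_sup add_sup_distrib_left add_uminus_conv_diff)
  thus ?thesis by (simp only: w_def diff_le_eq add.commute)
qed

text \<open>The factor 1 + c dominates both \<open>c\<close> and 1, hence covers both arguments of
  the infimum.\<close>

lemma inf_scaleR_le:
  fixes x b :: "'a::banach_lattice"
  assumes c: "0 \<le> c" and x: "0 \<le> x" and b: "0 \<le> b"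
  shows "inf (c *\<^sub>R x) b \<le> (1 + c) *\<^sub>R inf x b"
proof -
  have *: "inverse (1 + c) *\<^sub>R y \<le> z" if "y \<le> (1 + c) *\<^sub>R z" for y z :: 'a
  proof -
    have "inverse (1 + c) *\<^sub>R y \<le> inverse (1 + c) *\<^sub>R (1 + c) *\<^sub>R z"
      using c that by (intro scaleR_left_mono) auto
    thus ?thesis using c by simp
  qed
  have "inf (c *\<^sub>R x) b \<le> (1 + c) *\<^sub>R x"
    using x by (intro le_infI1 scaleR_right_mono) auto
  moreover have "b \<le> (1 + c) *\<^sub>R b" using scaleR_right_mono[of 1 "1 + c" b] c b by simp
  hence "inf (c *\<^sub>R x) b \<le> (1 + c) *\<^sub>R b" by (intro le_infI2)
  ultimately have "inverse (1 + c) *\<^sub>R inf (c *\<^sub>R x) b \<le> inf x b" by (intro inf_greatest *)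
  hence "(1 + c) *\<^sub>R inverse (1 + c) *\<^sub>R inf (c *\<^sub>R x) b \<le> (1 + c) *\<^sub>R inf x b"
    using c by (intro scaleR_left_mono) auto
  thus ?thesis using c by simp
qed

text \<open>The null ideal argument is used twice. The truncated map x \<mapsto> N (inf x b), which
  need not be linear, vanishes at \<open>a\<close> and hence at \<open>b\<close>, giving N b = 0;
  then \<open>N\<close> itself vanishes at the quasi-interior \<open>b\<close>.\<close>

lemma positive_operator_null:
  fixes N :: "'a::banach_lattice \<Rightarrow> 'a"
  assumes N: "linear N" "\<And>x. 0 \<le> x \<Longrightarrow> 0 \<le> N x" and F: "csubspace F"
    and a: "quasi_interior_point F (Cplx a 0)" and b: "quasi_interior_point F (Cplx b 0)"
    and ab: "N (inf a b) = 0" and z: "z \<in> F"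
  shows "N (modulus z) = 0"
proof -
  have pos: "0 \<le> a" "0 \<le> b" using a b by (auto simp: quasi_interior_point_def positive_cone_def)
  have mono: "N x \<le> N y" if "x \<le> y" for x y by (rule positive_linear_mono[OF N that])
  obtain K where K: "\<And>x. norm (N x) \<le> K * norm x"
    using bounded_linear.bounded[OF positive_linear_bounded[OF N]] by (auto simp: mult.commute)
  have "N (inf (modulus (Cplx b 0)) b) = 0"
  proof (rule null_if_null_quasi_interior[OF F a, where M = "\<lambda>x. N (inf x b)" and K = "\<bar>K\<bar>"])
    show "N (inf (modulus (Cplx a 0)) b) = 0" using ab pos by simp
    show "N (inf 0 b) = 0" using pos by (simp add: inf_absorb1 linear_0[OF N(1)])
    show "N (inf x b) \<le> N (inf y b)" if "x \<le> y" for x y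
      by (intro mono inf_mono that order_refl)
    show "N (inf (x + y) b) \<le> N (inf x b) + N (inf y b)" if "0 \<le> x" "0 \<le> y" for x y
      using mono[OF inf_add_le[OF that pos(2)]] by (simp add: linear_add[OF N(1)])
    show "N (inf (c *\<^sub>R x) b) = 0" if "0 \<le> c" "0 \<le> x" "N (inf x b) = 0" for c x
    proof (rule antisym)
      show "N (inf (c *\<^sub>R x) b) \<le> 0"
        using mono[OF inf_scaleR_le[OF that(1,2) pos(2)]] that(3) by (simp add: linear_scale[OF N(1)])
      show "0 \<le> N (inf (c *\<^sub>R x) b)"
        using that pos by (intro N(2) inf_greatest scaleR_nonneg_nonneg)
    qed
    show "norm (N (inf x b)) \<le> \<bar>K\<bar> * norm x" if "0 \<le> x" for x
    proof -
      have "norm (N (inf x b)) \<le> norm (N x)"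
        using that pos by (intro norm_mono_nonneg N(2) mono) auto
      also have "\<dots> \<le> K * norm x" by (rule K)
      also have "\<dots> \<le> \<bar>K\<bar> * norm x" by (intro mult_right_mono) auto
      finally show ?thesis .
    qed
    show "Cplx b 0 \<in> F" using b by (simp add: quasi_interior_point_def)
  qed
  hence "N b = 0" using pos by simp
  show ?thesis
  proof (rule null_if_null_quasi_interior[OF F b, where M = N and K = K])
    show "N (modulus (Cplx b 0)) = 0" using \<open>N b = 0\<close> pos by simp
    show "N (c *\<^sub>R x) = 0" if "N x = 0" for c x using that by (simp add: linear_scale[OF N(1)])
    show "N (x + y) \<le> N x + N y" for x y by (simp add: linear_add[OF N(1)])
  qed (simp_all only: linear_0[OF N(1)] mono K z)
qed


section \<open>Antiperiodic vectors\<close>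

lemma strong_LEP_rescaled:
  assumes T: "strong_LEP Q T" and Q: "\<And>n. clinear (Q n)"
  shows "strong_LEP Q (rescaled_semigroup s T)"
  unfolding strong_LEP_def
proof (intro allI ballI)
  fix n and f :: "'a complexification" assume "f \<in> positive_cone - {0}"
  then obtain \<tau> where \<tau>: "\<tau> > 0" "\<And>t. t \<ge> \<tau> \<Longrightarrow> Q n (T t f) \<in> positive_cone"
    "\<And>t. t \<ge> \<tau> \<Longrightarrow> quasi_interior_point (closed_sublattice_generated_by (range (Q n))) (Q n (T t f))"
    using T unfolding strong_LEP_def by meson
  have eq: "Q n (rescaled_semigroup s T t f) = exp (- (t * s)) *\<^sub>R Q n (T t f)" for t
    by (simp add: rescaled_semigroup_def linear_scale[OF clinear_linear[OF Q]])
  have "exp (- (t * s)) *\<^sub>R Q n (T t f) \<in> positive_cone" if "t \<ge> \<tau>" for t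
    using \<tau>(2)[OF that] by (auto simp: positive_cone_def intro: scaleR_nonneg_nonneg)
  thus "\<exists>\<tau>>0. \<forall>t\<ge>\<tau>. Q n (rescaled_semigroup s T t f) \<in> positive_cone \<and>
      quasi_interior_point (closed_sublattice_generated_by (range (Q n))) (Q n (rescaled_semigroup s T t f))"
    unfolding eq using \<tau>
    by (intro exI[of _ \<tau>] conjI allI impI quasi_interior_point_scaleR
        csubspace_closed_sublattice_generated_by) auto
qed

text \<open>The core of part (ii), for the semigroup after rescaling; a real vector with T(\<sigma>)
  g = -g takes the place of a complex eigenvector.\<close>

lemma antiperiodic_zero:
  fixes T :: "real \<Rightarrow> 'a::banach_lattice complexification \<Rightarrow> 'a complexification"
  assumes T: "C0_semigroup T" "real_semigroup T"
    and Q: "\<And>n. lattice_homomorphism (Q n)" "increasing_operators Q" "strongly_to_id Q"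
    and LEP: "strong_LEP Q T" and wc: "\<And>f. relatively_weakly_compact (orbit T f)"
    and \<sigma>: "\<sigma> > 0" and g: "T \<sigma> (Cplx g 0) = - Cplx g 0"
  shows "g = 0"
proof (rule ccontr)
  assume g0: "g \<noteq> 0"
  have Qpos: "positive_operator (Q n)" for n by (rule lattice_homomorphism_positive[OF Q(1)])
  define q where "q n = real_restriction (Q n)" for n
  have QC: "Q n (Cplx x 0) = Cplx (q n x) 0" for n x
    unfolding q_def by (rule positive_operator_of_real(1)[OF Qpos])
  have q_lin: "linear (q n)" for n
    unfolding q_def using Qpos by (intro linear_real_restriction) (simp add: positive_operator_def)
  have q_pos: "0 \<le> q n x" if "0 \<le> x" for n x
    unfolding q_def by (rule positive_operator_of_real(2)[OF Qpos that])
  have q_lim: "(\<lambda>n. q n x) \<longlonglongrightarrow> x" and q_le: "0 \<le> x \<Longrightarrow> q n x \<le> x" for n x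
    unfolding q_def by (rule increasing_operators_le[OF Qpos Q(2,3)])+
  have q_inf: "q n (inf x y) = inf (q n x) (q n y)" for n x y
    using Q(1)[of n] by (simp add: lattice_homomorphism_def q_def real_restriction_def)

  define r where "r = real_restriction (T (2 * \<sigma>))"
  have r: "bounded_linear r"
    unfolding r_def by (rule bounded_linear_real_restriction[OF C0_semigroupD(1)[OF T(1)]]) (use \<sigma> in simp)
  have TC: "T (2 * \<sigma>) (Cplx x 0) = Cplx (r x) 0" for x
    unfolding r_def using T(2) \<sigma> by (intro real_operator_of_real) (simp add: real_semigroup_def)
  have T_pow: "T (real k * (2 * \<sigma>)) (Cplx x 0) = Cplx ((r ^^ k) x) 0" for k x
  proof (induction k)
    case (Suc k)
    have "real (Suc k) * (2 * \<sigma>) = 2 * \<sigma> + real k * (2 * \<sigma>)" by (simp add: algebra_simps)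
    thus ?case using C0_semigroupD(4)[OF T(1), of "2 * \<sigma>" "real k * (2 * \<sigma>)"] \<sigma> Suc by (simp add: TC)
  qed (simp add: C0_semigroupD(3)[OF T(1)])
  have lin\<sigma>: "linear (T \<sigma>)" using \<sigma> by (intro clinear_linear C0_semigroupD(2)[OF T(1)]) simp
  have "Cplx (r g) 0 = T (\<sigma> + \<sigma>) (Cplx g 0)" by (simp add: TC[symmetric])
  also have "\<dots> = Cplx g 0"
    using C0_semigroupD(4)[OF T(1), of \<sigma> \<sigma>] \<sigma> by (simp add: g linear_neg[OF lin\<sigma>])
  finally have rg: "r g = g" by simp

  \<comment> \<open>The offset \<open>c\<close> is used as 0, giving iterates of \<open>r\<close>,
    and as \<sigma>, giving odd multiples of \<sigma>, where antiperiodic vectors change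
    sign.\<close>
  have LEP_pow: "\<exists>k0. \<forall>k\<ge>k0. Q n (T (c + real k * (2 * \<sigma>)) (Cplx x 0)) \<in> positive_cone \<and>
      quasi_interior_point (closed_sublattice_generated_by (range (Q n)))
        (Q n (T (c + real k * (2 * \<sigma>)) (Cplx x 0)))"
    if x: "0 \<le> x" "x \<noteq> 0" and c: "0 \<le> c" for n x c
  proof -
    have "Cplx x 0 \<in> positive_cone - {0}"
      using x by (auto simp: positive_cone_def zero_complexification_def)
    then obtain \<tau> where \<tau>: "\<And>t. t \<ge> \<tau> \<Longrightarrow> Q n (T t (Cplx x 0)) \<in> positive_cone"
      "\<And>t. t \<ge> \<tau> \<Longrightarrow> quasi_interior_point (closed_sublattice_generated_by (range (Q n))) (Q n (T t (Cplx x 0)))"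
      using LEP unfolding strong_LEP_def by meson
    obtain k0 :: nat where "\<tau> / (2 * \<sigma>) \<le> real k0" using real_arch_simple by blast
    hence k0: "\<tau> \<le> real k0 * (2 * \<sigma>)" using \<sigma> by (simp add: field_simps)
    have "\<tau> \<le> c + real k * (2 * \<sigma>)" if "k \<ge> k0" for k
    proof -
      have "real k0 * (2 * \<sigma>) \<le> real k * (2 * \<sigma>)" using that \<sigma> by (intro mult_right_mono) auto
      thus ?thesis using k0 c by simp
    qed
    thus ?thesis using \<tau> by blast
  qed

  have ev: "eventually (\<lambda>k. 0 \<le> q n ((r ^^ k) x)) sequentially" if x: "0 \<le> x" for n x
  proof (cases "x = 0")
    case True
    thus ?thesis by (simp add: linear_0[OF q_lin] linear_0[OF linear_funpow[OF bounded_linear.linear[OF r]]])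
  next
    case False
    show ?thesis
      using LEP_pow[OF x False, of 0 n]
      by (auto simp: eventually_sequentially T_pow QC positive_cone_def)
  qed

  define K where "K x = {y. Cplx y 0 \<in> weak_topology closure_of (orbit T (Cplx x 0))}" for x
  have orbit_K: "(r ^^ k) x \<in> K x" for k x
  proof -
    have "Cplx ((r ^^ k) x) 0 \<in> orbit T (Cplx x 0)"
      unfolding orbit_def T_pow[symmetric] using \<sigma> by (intro CollectI exI conjI refl mult_nonneg_nonneg) auto
    thus ?thesis unfolding K_def using closure_of_subset[of "orbit T (Cplx x 0)" weak_topology] by auto
  qed
  have K_trans: "K y \<subseteq> K x" if "y \<in> K x" for x y
    using weak_orbit_closure_trans[OF T(1), of "Cplx y 0" "Cplx x 0"] that by (auto simp: K_def)
  obtain U where U: "U \<le> sequentially" "U \<noteq> bot"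
    and ultra: "\<And>P. eventually P U \<or> eventually (\<lambda>k. \<not> P k) U"
    using ex_ultrafilter[of sequentially] by auto
  have K_lim: "\<exists>y\<in>K x. wlim U X y" if X: "\<And>k. X k \<in> K x" for X x
  proof -
    have "compactin weak_topology (weak_topology closure_of (orbit T (Cplx x 0)))"
      using wc by (simp add: relatively_weakly_compact_def)
    then obtain z where z: "z \<in> weak_topology closure_of (orbit T (Cplx x 0))"
      "limitin weak_topology (\<lambda>k. Cplx (X k) 0) z U"
      using compactin_ultrafilter_limit[OF _ U(2) ultra, of _ _ "\<lambda>k. Cplx (X k) 0"] X
      unfolding K_def by blast
    \<comment> \<open>Weak limits of real vectors are real: the imaginary parts are constantly
      0.\<close>
    have "im_part z = 0"
      using wlim_unique[OF limitin_weak_topology_wlim(2)[OF z(2)] _ U(2)] wlim_const[of U 0] by simp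
    hence "z = Cplx (re_part z) 0" by (simp add: complexification_eqI)
    thus ?thesis using z limitin_weak_topology_wlim(1)[OF z(2)] unfolding K_def
      by (intro bexI[of _ "re_part z"]) auto
  qed

  obtain h N where h: "r h = h" "\<bar>g\<bar> \<le> h" and N: "linear N" "\<And>x. 0 \<le> x \<Longrightarrow> 0 \<le> N x"
    "N g = g" "N (h - \<bar>g\<bar>) = 0"
    using ex_fixed_modulus[OF r U(2,1) q_lin q_pos q_lim ev orbit_K K_trans K_lim rg] by blast
  define a where "a = h + g"
  define b where "b = h - g"
  have ab: "0 \<le> a" "0 \<le> b" "N (inf a b) = 0" "r a = a" "r b = b"
  proof -
    show "0 \<le> b" using h(2) abs_ge_self[of g] unfolding b_def by (metis diff_ge_0_iff_ge order_trans)
    have "- g \<le> h" using h(2) abs_ge_minus_self[of g] order_trans by blast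
    thus "0 \<le> a" unfolding a_def by (metis add.left_inverse add_right_mono)
    show "N (inf a b) = 0" using N(4) by (simp only: a_def b_def inf_add_diff_eq)
    show "r a = a" "r b = b" unfolding a_def b_def
      by (simp_all add: linear_add linear_diff bounded_linear.linear[OF r] h(1) rg)
  qed

  \<comment> \<open>At odd multiples of \<sigma> the orbit of \<open>x\<close> equals
    \<open>- x\<close>; LEP makes \<open>q n (- x)\<close> positive, and the limit in
    \<open>n\<close> gives x \<le> 0.\<close>
  have no_sign: "x = 0" if x: "0 \<le> x" "T \<sigma> (Cplx x 0) = - Cplx x 0" "r x = x" for x
  proof (rule ccontr)
    assume x0: "x \<noteq> 0"
    have "0 \<le> q n (- x)" for n
    proof -
      obtain k where k: "Q n (T (\<sigma> + real k * (2 * \<sigma>)) (Cplx x 0)) \<in> positive_cone"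
        using LEP_pow[OF x(1) x0, of \<sigma> n] \<sigma> by auto
      have "T (\<sigma> + real k * (2 * \<sigma>)) (Cplx x 0) = T \<sigma> (T (real k * (2 * \<sigma>)) (Cplx x 0))"
        using \<sigma> by (intro C0_semigroupD(4)[OF T(1)]) auto
      also have "\<dots> = Cplx (- x) 0" by (simp add: T_pow funpow_fixed[of r, OF x(3)] x(2) Cplx_uminus)
      finally show ?thesis using k by (simp add: QC positive_cone_def)
    qed
    hence "0 \<le> - x" by (intro lim_nonneg[OF q_lim]) simp
    thus False using x(1) x0 by simp
  qed
  \<comment> \<open>Otherwise -g = h would be a positive antiperiodic vector; for \<open>b\<close>
    the same holds with g = h.\<close>
  have "a \<noteq> 0"
  proof
    assume "a = 0"
    hence "g = - h" by (simp add: a_def eq_neg_iff_add_eq_0 add.commute)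
    moreover have "0 \<le> h" using h(2) abs_ge_zero order_trans by blast
    moreover have "T \<sigma> (Cplx (- g) 0) = - Cplx (- g) 0"
      unfolding Cplx_uminus by (simp add: linear_neg[OF lin\<sigma>] g)
    ultimately have "- g = 0" using h(1) by (intro no_sign) simp_all
    thus False using g0 by simp
  qed
  have "b \<noteq> 0"
  proof
    assume "b = 0"
    hence "g = h" by (simp add: b_def)
    moreover have "0 \<le> h" using h(2) abs_ge_zero order_trans by blast
    ultimately have "g = 0" using g rg by (intro no_sign) simp_all
    thus False using g0 by simp
  qed

  \<comment> \<open>An \<open>r\<close>-fixed vector recurs at arbitrarily late times, so the
    eventual property holds for the vector itself.\<close>
  have qi: "quasi_interior_point (closed_sublattice_generated_by (range (Q n))) (Cplx (q n x) 0)"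
    if "0 \<le> x" "x \<noteq> 0" "r x = x" for x n
    using LEP_pow[OF that(1,2), of 0 n] by (auto simp: T_pow funpow_fixed[of r, OF that(3)] QC)
  have "N (q n g) = 0" for n
  proof -
    \<comment> \<open>The homomorphism property identifies this infimum with
      \<open>q n (inf a b)\<close>, which lies below the \<open>N\<close>-null vector
      \<open>inf a b\<close>.\<close>
    have "N (inf (q n a) (q n b)) = 0"
    proof (rule antisym)
      have le: "q n (inf a b) \<le> inf a b" using ab by (intro q_le) simp
      have "N (q n (inf a b)) \<le> N (inf a b)" by (rule positive_linear_mono[OF N(1) N(2) le])
      thus "N (inf (q n a) (q n b)) \<le> 0" using ab(3) by (simp add: q_inf)
      show "0 \<le> N (inf (q n a) (q n b))" using ab by (intro N(2)) (simp add: q_pos)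
    qed
    hence "N (modulus (Q n (Cplx g 0))) = 0"
      by (intro positive_operator_null[OF N(1,2) csubspace_closed_sublattice_generated_by qi qi])
         (use ab \<open>a \<noteq> 0\<close> \<open>b \<noteq> 0\<close> range_subset_closed_sublattice_generated_by in auto)
    hence "N \<bar>q n g\<bar> = 0" by (simp add: QC)
    thus ?thesis using positive_linear_abs_le[OF N(1,2), of "q n g"] by simp
  qed
  moreover have "(\<lambda>n. N (q n g)) \<longlonglongrightarrow> N g"
    by (rule bounded_linear.tendsto[OF positive_linear_bounded[OF N(1,2)] q_lim])
  ultimately have "N g = 0" by (simp add: LIMSEQ_const_iff)
  thus False using N(3) g0 by simp
qed

section \<open>From peripheral eigenvalues to antiperiodic vectors\<close>

lemma peripheral_eigenvalue_trivial:
  fixes T :: "real \<Rightarrow> 'a::banach_lattice complexification \<Rightarrow> 'a complexification"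
  assumes T: "C0_semigroup T" "real_semigroup T"
    and Q: "\<And>n. lattice_homomorphism (Q n)" "increasing_operators Q" "strongly_to_id Q" "strong_LEP Q T"
    and wc: "\<And>f. relatively_weakly_compact (orbit (rescaled_semigroup s T) f)"
    and \<mu>: "\<mu> \<in> point_spectrum (generator_domain T) (generator T)" "Re \<mu> = s"
  shows "\<mu> = complex_of_real s"
proof (rule ccontr)
  assume "\<mu> \<noteq> complex_of_real s"
  hence \<beta>: "Im \<mu> \<noteq> 0" using \<mu>(2) by (auto simp: complex_eq_iff)
  obtain f where f: "f \<in> generator_domain T" "f \<noteq> 0" "generator T f = \<mu> *\<^sub>C f"
    using \<mu>(1) by (auto simp: point_spectrum_def)
  define S where "S = rescaled_semigroup s T"
  have S: "C0_semigroup S" "real_semigroup S"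
    unfolding S_def by (rule rescaled_C0_semigroup[OF T(1)] rescaled_real_semigroup[OF T(2,1)])+
  \<comment> \<open>Half the rotation period of the eigenvalue: here the rescaled semigroup acts on
    \<open>f\<close> as -1 and, being real, does so on both parts of \<open>f\<close>.\<close>
  define \<sigma> where "\<sigma> = pi / \<bar>Im \<mu>\<bar>"
  have \<sigma>: "\<sigma> > 0" using \<beta> by (simp add: \<sigma>_def)
  have "cis (Im \<mu> * \<sigma>) = - 1"
    using \<beta> by (auto simp: \<sigma>_def complex_eq_iff abs_if)
  moreover have "exp (\<mu> * of_real \<sigma>) = of_real (exp (s * \<sigma>)) * cis (Im \<mu> * \<sigma>)"
    using \<mu>(2) by (simp add: exp_eq_polar)
  ultimately have "exp (\<mu> * of_real \<sigma>) = - of_real (exp (s * \<sigma>))" by simp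
  hence "S \<sigma> f = (of_real (exp (- (\<sigma> * s))) * - of_real (exp (s * \<sigma>))) *\<^sub>C f"
    using semigroup_eigenvector[OF T(1) f(1,3), of \<sigma>] \<sigma>
    by (simp add: S_def rescaled_semigroup_def scaleC_scaleC del: of_real_exp flip: scaleC_of_real)
  also have "of_real (exp (- (\<sigma> * s))) * - of_real (exp (s * \<sigma>)) = (- 1 :: complex)"
    by (simp add: mult.commute flip: exp_add of_real_mult exp_of_real)
  finally have Sf: "S \<sigma> f = (- 1) *\<^sub>C f" .
  have real: "real_operator (S \<sigma>)" using S(2) \<sigma> by (simp add: real_semigroup_def)
  have "real_restriction (S \<sigma>) (re_part f) = - re_part f" "real_restriction (S \<sigma>) (im_part f) = - im_part f"
    using Sf real_operator_Cplx[OF real, of f] by (auto simp: scaleC_def)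
  hence "S \<sigma> (Cplx (re_part f) 0) = - Cplx (re_part f) 0" "S \<sigma> (Cplx (im_part f) 0) = - Cplx (im_part f) 0"
    by (simp_all add: real_operator_of_real[OF real] Cplx_uminus)
  moreover have "strong_LEP Q S"
    unfolding S_def using Q(1,4)
    by (intro strong_LEP_rescaled) (auto simp: lattice_homomorphism_def real_operator_def)
  ultimately have "re_part f = 0" "im_part f = 0"
    using antiperiodic_zero[OF S Q(1-3) _ wc[folded S_def] \<sigma>] by blast+
  thus False using f(2) by (simp add: complexification_eqI)
qed

section \<open>Asymptotic positivity and triviality of the peripheral point spectrum\<close>

theorem theorem1p1:
  fixes T :: "real \<Rightarrow> 'a::banach_lattice complexification \<Rightarrow> 'a complexification"
  assumes "C0_semigroup T" and "real_semigroup T"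
    and "spectral_bound (generator_domain T) (generator T) > -\<infinity>"
  shows
    "((\<exists>P. (\<forall>n. positive_operator (P n)) \<and> increasing_operators P \<and> strongly_to_id P \<and> LEP P T) \<and>
      (\<forall>f. relatively_compact (orbit T f))
      \<longrightarrow> (\<forall>f\<in>positive_cone. ((\<lambda>t. infdist (T t f) positive_cone) \<longlongrightarrow> 0) at_top))
     \<and>
     (let s = real_of_ereal (spectral_bound (generator_domain T) (generator T)) in
      (\<exists>Q. (\<forall>n. lattice_homomorphism (Q n)) \<and> increasing_operators Q \<and> strongly_to_id Q \<and> strong_LEP Q T) \<and>
      (\<forall>f. relatively_weakly_compact (orbit (rescaled_semigroup s T) f))
      \<longrightarrow> point_spectrum (generator_domain T) (generator T) \<inter>
            {complex_of_real s + \<i> * complex_of_real \<beta> | \<beta>. True} \<subseteq> {complex_of_real s})"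
  unfolding Let_def
proof (intro conjI impI ballI subsetI; elim conjE exE)
  fix f :: "'a complexification" and P
  assume "f \<in> positive_cone" "\<forall>n. positive_operator (P n)" "increasing_operators P"
    "strongly_to_id P" "LEP P T" "\<forall>f. relatively_compact (orbit T f)"
  thus "((\<lambda>t. infdist (T t f) positive_cone) \<longlongrightarrow> 0) at_top"
    using C0_semigroupD(2)[OF assms(1)] by (intro LEP_infdist_tendsto_0) auto
next
  fix \<mu> Q
  define s where "s = real_of_ereal (spectral_bound (generator_domain T) (generator T))"
  assume \<mu>: "\<mu> \<in> point_spectrum (generator_domain T) (generator T) \<inter>
      {complex_of_real (real_of_ereal (spectral_bound (generator_domain T) (generator T)))
        + \<i> * complex_of_real \<beta> | \<beta>. True}"
    and Q: "\<forall>n. lattice_homomorphism (Q n)" "increasing_operators Q" "strongly_to_id Q" "strong_LEP Q T"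
    and wc: "\<forall>f. relatively_weakly_compact
      (orbit (rescaled_semigroup (real_of_ereal (spectral_bound (generator_domain T) (generator T))) T) f)"
  have "\<mu> = complex_of_real s"
  proof (rule peripheral_eigenvalue_trivial[OF assms(1,2)])
    show "lattice_homomorphism (Q n)" for n using Q(1) by blast
  qed (use \<mu> Q wc in \<open>auto simp: s_def\<close>)
  thus "\<mu> \<in> {complex_of_real (real_of_ereal (spectral_bound (generator_domain T) (generator T)))}"
    by (simp add: s_def)
qed

end
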